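(* Let $A$ be a $\mathrm{C}^*$-algebra. For each closed two-sided ideal $I$ of $A$ let $$\mathrm{G}_{A,I}=\{a\in \mathrm{G}_A \mid (a,\mathrm{G}_A)\subseteq \overline{(\mathrm{G}_I,\mathrm{G}_A)}\}.$$ Then for every closed normal subgroup $H$ of $\mathrm{G}_A$ there exists a closed two-sided ideal $I$ of $A$ (namely, the one generated by $[H,A]$) such that $$\overline{(\mathrm{G}_I,\mathrm{G}_A)}\subseteq H\subseteq \mathrm{G}_{A,I}.$$ Conversely, if $I$ is a closed two-sided ideal of $A$, then any subgroup $H\subseteq \mathrm{G}_A$ such that $\overline{(\mathrm{G}_I,\mathrm{G}_A)}\subseteq H\subseteq \mathrm{G}_{A,I}$ is normal in $\mathrm{G}_A$.
   Context: $A$ is not assumed unital. $A^\sim$ denotes the minimal unitization of $A$ ($A^\sim=A$ if $A$ is unital). $\mathrm{GL}(A)$ is the group of invertible elements of $A$ if $A$ is unital; if $A$ is non-unital, $\mathrm{GL}(A)$ is the group of invertible elements of $A^\sim$ of the form $1+x$ with $x\in A$. It carries the norm topology, and $\mathrm{G}_A$ denotes its connected component of the identity. For a closed two-sided ideal $I$ of $A$, $I^\sim$ is regarded as a subalgebra of $A^\sim$ (elements $\lambda 1+x$ with $x\in I$, with $1$ the unit of $A^\sim$), and in this way $\mathrm{G}_I$ is regarded as a closed normal subgroup of $\mathrm{G}_A$. Write $[x,y]=xy-yx$ and $(x,y)=xyx^{-1}y^{-1}$ (for invertible $x,y$). For sets, $[X,Y]$ is the linear span of $\{[x,y]: x\in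 X,y\in Y\}$ and $(X,Y)$ is the subgroup generated by $\{(x,y): x\in X,y\in Y\}$; $(a,\mathrm{G}_A)$ means $(\{a\},\mathrm{G}_A)$. Overlines denote norm closure; "closed" means norm closed. *)

theory Defs
  imports "HOL-Analysis.Analysis" "HOL-Algebra.Generated_Groups"
begin

section \<open>C*-algebras\<close>

text \<open>
  Complex C*-algebras, not assumed unital (nor nonzero). The real structure inherited from
  \<^class>\<open>real_normed_algebra\<close> is the restriction of the complex one.
\<close>

class cstar_algebra = real_normed_algebra + banach +
  fixes scaleC :: "complex \<Rightarrow> 'a \<Rightarrow> 'a" (infixr "*\<^sub>C" 75)
    and star :: "'a \<Rightarrow> 'a"
  assumes scaleC_add_right: "c *\<^sub>C (x + y) = c *\<^sub>C x + c *\<^sub>C y"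
    and scaleC_add_left: "(c + d) *\<^sub>C x = c *\<^sub>C x + d *\<^sub>C x"
    and scaleC_scaleC: "c *\<^sub>C (d *\<^sub>C x) = (c * d) *\<^sub>C x"
    and scaleC_of_real: "complex_of_real r *\<^sub>C x = r *\<^sub>R x"
    and mult_scaleC_left: "(c *\<^sub>C x) * y = c *\<^sub>C (x * y)"
    and mult_scaleC_right: "x * (c *\<^sub>C y) = c *\<^sub>C (x * y)"
    and norm_scaleC: "norm (c *\<^sub>C x) = cmod c * norm x"
    and star_star: "star (star x) = x"
    and star_add: "star (x + y) = star x + star y"
    and star_scaleC: "star (c *\<^sub>C x) = cnj c *\<^sub>C star x"
    and star_mult: "star (x * y) = star y * star x"
    and norm_star_mult: "norm (star x * x) = (norm x)\<^sup>2"

lemma vector_space_scaleC: "vector_space ((*\<^sub>C) :: complex \<Rightarrow> 'a::cstar_algebra \<Rightarrow> 'a)"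
proof
  fix x :: 'a
  show "1 *\<^sub>C x = x"
    using scaleC_of_real[of 1 x] by simp
qed (simp_all add: scaleC_add_right scaleC_add_left scaleC_scaleC)

definition closed_ideal :: "'a::cstar_algebra set \<Rightarrow> bool" where
  "closed_ideal I \<longleftrightarrow> module.subspace (*\<^sub>C) I \<and> (\<forall>a. \<forall>x\<in>I. a * x \<in> I \<and> x * a \<in> I) \<and> closed I"


section \<open>The minimal unitization\<close>

definition is_unit_element :: "'a::cstar_algebra \<Rightarrow> bool" where
  "is_unit_element e \<longleftrightarrow> (\<forall>x. e * x = x \<and> x * e = x)"

definition unital :: "'a::cstar_algebra itself \<Rightarrow> bool" where
  "unital _ \<longleftrightarrow> (\<exists>e::'a. is_unit_element e)"

text \<open>
  The pair \<open>(x, c)\<close> stands for \<open>c 1 + x\<close>. If \<open>A\<close> is unital, then \<open>A\<^sup>~ = A\<close> consists of the pairs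
  \<open>(x, 0)\<close>, with the unit of \<open>A\<close>; otherwise it consists of all pairs, with unit \<open>(0, 1)\<close>.

  The topology is the one of the product type. It is the norm topology of \<open>A\<^sup>~\<close>: if \<open>A\<close> is unital,
  then the product norm of \<open>(x, 0)\<close> is the norm of \<open>x\<close>; otherwise \<open>A\<close> is a closed subspace of
  codimension 1 in \<open>A\<^sup>~\<close> with its C*-norm, which is therefore equivalent to the product norm (and on
  elements \<open>1 + x\<close> with \<open>x\<close> in \<open>A\<close> both norms induce the metric of \<open>A\<close>).
\<close>

definition emb :: "'a::cstar_algebra \<Rightarrow> 'a \<times> complex" where
  "emb x = (x, 0)"

definition umult :: "'a::cstar_algebra \<times> complex \<Rightarrow> 'a \<times> complex \<Rightarrow> 'a \<times> complex" where
  "umult u v = (fst u * fst v + snd u *\<^sub>C fst v + snd v *\<^sub>C fst u, snd u * snd v)"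

definition uscale :: "complex \<Rightarrow> 'a::cstar_algebra \<times> complex \<Rightarrow> 'a \<times> complex" where
  "uscale c u = (c *\<^sub>C fst u, c * snd u)"

definition unitization :: "('a::cstar_algebra \<times> complex) monoid" where
  "unitization =
     (if unital TYPE('a)
      then \<lparr>carrier = range emb, monoid.mult = umult, one = emb (THE e. is_unit_element e)\<rparr>
      else \<lparr>carrier = UNIV, monoid.mult = umult, one = (0, 1)\<rparr>)"

text \<open>The subalgebra \<open>I\<^sup>~\<close> of \<open>A\<^sup>~\<close>, sharing the unit of \<open>A\<^sup>~\<close>.\<close>

definition ideal_unitization :: "'a::cstar_algebra set \<Rightarrow> ('a \<times> complex) monoid" where
  "ideal_unitization I =
     unitization\<lparr>carrier := {uscale c \<one>\<^bsub>unitization\<^esub> + emb x | c x. x \<in> I}\<rparr>"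

text \<open>The linear span of the commutators \<open>[x, y] = x y - y x\<close>, taken in \<open>A\<^sup>~\<close>.\<close>

definition lie_bracket ::
    "('a::cstar_algebra \<times> complex) set \<Rightarrow> ('a \<times> complex) set \<Rightarrow> ('a \<times> complex) set" where
  "lie_bracket X Y = module.span uscale {umult x y - umult y x | x y. x \<in> X \<and> y \<in> Y}"


section \<open>Invertible elements and the identity component\<close>

definition GL :: "('a::cstar_algebra \<times> complex) set" where
  "GL = (if unital TYPE('a) then Units unitization
         else {u \<in> Units unitization. \<exists>x. u = \<one>\<^bsub>unitization\<^esub> + emb x})"

text \<open>
  \<open>GL(I)\<close> inside \<open>A\<^sup>~\<close>. If \<open>I\<close> has a unit \<open>e\<close> of its own, then an invertible element \<open>g\<close> of \<open>I\<close>
  appears as \<open>1 + (g - e)\<close>; see \<open>GL_ideal_unital\<close> below.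
\<close>

definition GL_ideal :: "'a::cstar_algebra set \<Rightarrow> ('a \<times> complex) set" where
  "GL_ideal I = {u \<in> Units (ideal_unitization I). \<exists>x\<in>I. u = \<one>\<^bsub>unitization\<^esub> + emb x}"

definition G_A :: "('a::cstar_algebra \<times> complex) monoid" where
  "G_A = unitization\<lparr>carrier := connected_component_set GL \<one>\<^bsub>unitization\<^esub>\<rparr>"

definition G_ideal :: "'a::cstar_algebra set \<Rightarrow> ('a \<times> complex) set" where
  "G_ideal I = connected_component_set (GL_ideal I) \<one>\<^bsub>unitization\<^esub>"

definition comm_subgroup ::
    "('a::cstar_algebra \<times> complex) set \<Rightarrow> ('a \<times> complex) set \<Rightarrow> ('a \<times> complex) set" where
  "comm_subgroup X Y =
     generate G_A {x \<otimes>\<^bsub>G_A\<^esub> y \<otimes>\<^bsub>G_A\<^esub> inv\<^bsub>G_A\<^esub> x \<otimes>\<^bsub>G_A\<^esub> inv\<^bsub>G_A\<^esub> y | x y. x \<in> X \<and> y \<in> Y}"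

text \<open>
  The closure of \<open>(G\<^sub>I, G\<^sub>A)\<close> is taken within the topological group \<open>G\<^sub>A\<close>: in \<open>A\<^sup>~\<close> a norm limit of
  invertible elements need not be invertible.
\<close>

definition closed_comm_subgroup :: "'a::cstar_algebra set \<Rightarrow> ('a \<times> complex) set" where
  "closed_comm_subgroup I =
     top_of_set (carrier G_A) closure_of comm_subgroup (G_ideal I) (carrier G_A)"

definition G_rel :: "'a::cstar_algebra set \<Rightarrow> ('a \<times> complex) set" where
  "G_rel I = {a \<in> carrier G_A. comm_subgroup {a} (carrier G_A) \<subseteq> closed_comm_subgroup I}"


section \<open>Consistency of the definitions\<close>

lemma vector_space_uscale:
  "vector_space (uscale :: complex \<Rightarrow> 'a::cstar_algebra \<times> complex \<Rightarrow> 'a \<times> complex)"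
proof -
  interpret C: vector_space "(*\<^sub>C) :: complex \<Rightarrow> 'a \<Rightarrow> 'a"
    by (rule vector_space_scaleC)
  show ?thesis
    by unfold_locales (auto simp: uscale_def algebra_simps C.scale_right_distrib C.scale_left_distrib)
qed

lemma the_unit_element:
  assumes "is_unit_element (e::'a::cstar_algebra)"
  shows "(THE e. is_unit_element e) = e"
  using assms by (intro the_equality) (auto simp: is_unit_element_def, metis)

lemma umult_assoc: "umult (umult u v) w = umult u (umult v (w :: 'a::cstar_algebra \<times> complex))"
proof -
  interpret C: vector_space "(*\<^sub>C) :: complex \<Rightarrow> 'a \<Rightarrow> 'a"
    by (rule vector_space_scaleC)
  show ?thesis
    by (simp add: umult_def algebra_simps mult_scaleC_left mult_scaleC_right C.scale_right_distrib)
qed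

lemma mult_unitization [simp]: "monoid.mult unitization = umult"
  by (simp add: unitization_def)

lemma monoid_unitization: "monoid (unitization :: ('a::cstar_algebra \<times> complex) monoid)"
proof -
  interpret C: vector_space "(*\<^sub>C) :: complex \<Rightarrow> 'a \<Rightarrow> 'a"
    by (rule vector_space_scaleC)
  show ?thesis
  proof (cases "unital TYPE('a)")
    case True
    then obtain e :: 'a where e: "is_unit_element e" by (auto simp: unital_def)
    then have *: "unitization = \<lparr>carrier = range emb, monoid.mult = umult, one = emb e\<rparr>"
      using True by (simp add: unitization_def the_unit_element[OF e])
    show ?thesis unfolding *
      using e by unfold_locales (auto simp: umult_assoc, auto simp: umult_def emb_def is_unit_element_def)
  next
    case False
    then show ?thesis
      by unfold_locales (auto simp: unitization_def umult_assoc, auto simp: umult_def)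
  qed
qed

lemma umult_add_left: "umult (u + v) w = umult u w + umult v (w :: 'a::cstar_algebra \<times> complex)"
proof -
  interpret C: vector_space "(*\<^sub>C) :: complex \<Rightarrow> 'a \<Rightarrow> 'a"
    by (rule vector_space_scaleC)
  show ?thesis
    by (simp add: umult_def algebra_simps C.scale_left_distrib C.scale_right_distrib)
qed

lemma umult_add_right: "umult w (u + v) = umult w u + umult w (v :: 'a::cstar_algebra \<times> complex)"
proof -
  interpret C: vector_space "(*\<^sub>C) :: complex \<Rightarrow> 'a \<Rightarrow> 'a"
    by (rule vector_space_scaleC)
  show ?thesis
    by (simp add: umult_def algebra_simps C.scale_left_distrib C.scale_right_distrib)
qed

lemma umult_emb: "umult (emb x) (emb y) = emb (x * (y :: 'a::cstar_algebra))"
proof -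
  interpret C: vector_space "(*\<^sub>C) :: complex \<Rightarrow> 'a \<Rightarrow> 'a"
    by (rule vector_space_scaleC)
  show ?thesis by (simp add: umult_def emb_def)
qed

lemma snd_umult: "snd (umult u v) = snd u * snd v"
  by (simp add: umult_def)

lemma carrier_unitization:
  "u \<in> carrier (unitization :: ('a::cstar_algebra \<times> complex) monoid) \<longleftrightarrow>
     unital TYPE('a) \<longrightarrow> snd u = 0"
  by (cases u) (auto simp: unitization_def emb_def)

lemma snd_one_unitization:
  "snd \<one>\<^bsub>unitization :: ('a::cstar_algebra \<times> complex) monoid\<^esub> = (if unital TYPE('a) then 0 else 1)"
  by (auto simp: unitization_def emb_def)

lemma GL_iff:
  "u \<in> GL \<longleftrightarrow> u \<in> Units unitization \<and>
     snd u = snd \<one>\<^bsub>unitization :: ('a \<times> complex) monoid\<^esub>"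
  for u :: "'a::cstar_algebra \<times> complex"
proof -
  have "(\<exists>x. u = v + emb x) \<longleftrightarrow> snd u = snd v" for v :: "'a \<times> complex"
  proof
    assume "snd u = snd v"
    then have "u = v + emb (fst u - fst v)" by (simp add: emb_def prod_eq_iff)
    then show "\<exists>x. u = v + emb x" ..
  qed (auto simp: emb_def)
  then show ?thesis
    by (auto simp: GL_def snd_one_unitization Units_def carrier_unitization)
qed

lemma GL_ideal_UNIV: "GL_ideal UNIV = (GL :: ('a::cstar_algebra \<times> complex) set)"
proof -
  interpret U: vector_space "uscale :: complex \<Rightarrow> 'a \<times> complex \<Rightarrow> 'a \<times> complex"
    by (rule vector_space_uscale)
  let ?M = "unitization :: ('a \<times> complex) monoid"
  have ex: "(\<exists>x. u = v + emb x) \<longleftrightarrow> snd u = snd v" for u v :: "'a \<times> complex"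
  proof
    assume "snd u = snd v"
    then have "u = v + emb (fst u - fst v)" by (simp add: emb_def prod_eq_iff)
    then show "\<exists>x. u = v + emb x" ..
  qed (auto simp: emb_def)
  have "{uscale c \<one>\<^bsub>?M\<^esub> + emb x | c x. x \<in> UNIV} = carrier ?M"
    by (auto simp: ex carrier_unitization uscale_def snd_one_unitization)
  then have "ideal_unitization UNIV = ?M"
    by (simp add: ideal_unitization_def)
  then show ?thesis
    by (auto simp: GL_ideal_def GL_iff ex)
qed

lemma GL_ideal_unital:
  fixes I :: "'a::cstar_algebra set"
  assumes I: "closed_ideal I" and e: "e \<in> I" "\<And>x. x \<in> I \<Longrightarrow> e * x = x \<and> x * e = x"
  shows "GL_ideal I =
    {\<one>\<^bsub>unitization\<^esub> + emb (g - e) | g. g \<in> I \<and> (\<exists>h\<in>I. g * h = e \<and> h * g = e)}"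
proof -
  interpret M: monoid "unitization :: ('a \<times> complex) monoid"
    by (rule monoid_unitization)
  interpret C: vector_space "(*\<^sub>C) :: complex \<Rightarrow> 'a \<Rightarrow> 'a"
    by (rule vector_space_scaleC)
  interpret U: vector_space "uscale :: complex \<Rightarrow> 'a \<times> complex \<Rightarrow> 'a \<times> complex"
    by (rule vector_space_uscale)
  let ?one = "\<one>\<^bsub>unitization :: ('a \<times> complex) monoid\<^esub>"
  have sub: "C.subspace I" and idl: "\<And>a x. x \<in> I \<Longrightarrow> a * x \<in> I \<and> x * a \<in> I"
    using I by (auto simp: closed_ideal_def)
  have emb_carrier: "emb x \<in> carrier unitization" for x :: 'a
    by (simp add: carrier_unitization emb_def)
  have one_left: "umult ?one u = u" and one_right: "umult u ?one = u"
    if "u \<in> carrier unitization" for u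
    using M.l_one[OF that] M.r_one[OF that] by simp_all
  have uscale_left: "umult (uscale c u) v = uscale c (umult u v)"
    and uscale_right: "umult v (uscale c u) = uscale c (umult v u)" for c and u v :: "'a \<times> complex"
    by (simp_all add: umult_def uscale_def algebra_simps mult_scaleC_left mult_scaleC_right
        C.scale_right_distrib)
  have emb_add: "emb (x + y) = emb x + emb y" for x y :: 'a
    by (simp add: emb_def)
  have uscale_emb: "uscale c (emb x) = emb (c *\<^sub>C x)" for c and x :: 'a
    by (simp add: emb_def uscale_def)
  have inj_emb: "emb x = emb y \<Longrightarrow> x = y" for x y :: 'a
    by (simp add: emb_def)
  have fields: "monoid.mult (ideal_unitization I) = umult" "\<one>\<^bsub>ideal_unitization I\<^esub> = ?one"
    by (simp_all add: ideal_unitization_def)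
  have comp: "\<exists>h\<in>I. umult (emb e) u = emb h \<and> umult u (emb e) = emb h"
    if "u \<in> carrier (ideal_unitization I)" for u
  proof -
    from that obtain c x where u: "u = uscale c ?one + emb x" and x: "x \<in> I"
      by (auto simp: ideal_unitization_def)
    have "umult (emb e) u = emb (c *\<^sub>C e + x)" "umult u (emb e) = emb (c *\<^sub>C e + x)"
      unfolding u umult_add_left umult_add_right uscale_left uscale_right
      using e(2)[OF x] by (simp_all add: one_left one_right emb_carrier uscale_emb umult_emb emb_add)
    moreover have "c *\<^sub>C e + x \<in> I"
      using sub x e(1) by (simp add: C.subspace_add C.subspace_scale)
    ultimately show ?thesis by blast
  qed
  show ?thesis
  proof (intro subset_antisym subsetI)
    fix u assume "u \<in> GL_ideal I"
    then obtain x v where x: "x \<in> I" "u = ?one + emb x" and u: "u \<in> carrier (ideal_unitization I)"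
      and v: "v \<in> carrier (ideal_unitization I)" "umult u v = ?one" "umult v u = ?one"
      unfolding GL_ideal_def Units_def fields by blast
    obtain h where h: "h \<in> I" "umult (emb e) v = emb h" "umult v (emb e) = emb h"
      using comp[OF v(1)] by blast
    have g: "umult (emb e) u = emb (x + e)" "umult u (emb e) = emb (x + e)"
      unfolding x(2) umult_add_left umult_add_right using e(2)[OF x(1)]
      by (simp_all add: one_left one_right emb_carrier umult_emb emb_add add.commute)
    have "emb ((x + e) * h) = umult (umult (emb e) u) (umult v (emb e))"
      by (simp add: g h umult_emb)
    also have "\<dots> = umult (emb e) (umult (umult u v) (emb e))"
      by (simp add: umult_assoc)
    also have "\<dots> = emb e"
      using e by (simp add: v one_left emb_carrier umult_emb)
    finally have 1: "(x + e) * h = e" by (rule inj_emb)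
    have "emb (h * (x + e)) = umult (umult (emb e) v) (umult u (emb e))"
      by (simp add: g h umult_emb)
    also have "\<dots> = umult (emb e) (umult (umult v u) (emb e))"
      by (simp add: umult_assoc)
    also have "\<dots> = emb e"
      using e by (simp add: v one_left emb_carrier umult_emb)
    finally have 2: "h * (x + e) = e" by (rule inj_emb)
    have "x + e \<in> I" using sub x(1) e(1) by (simp add: C.subspace_add)
    then show "u \<in> {?one + emb (g - e) | g. g \<in> I \<and> (\<exists>h\<in>I. g * h = e \<and> h * g = e)}"
      using 1 2 h(1) x(2) by (auto intro!: exI[of _ "x + e"])
  next
    fix u assume "u \<in> {?one + emb (g - e) | g. g \<in> I \<and> (\<exists>h\<in>I. g * h = e \<and> h * g = e)}"
    then obtain g h where gh: "g \<in> I" "h \<in> I" "g * h = e" "h * g = e" and u: "u = ?one + emb (g - e)"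
      by blast
    have mem: "?one + emb x \<in> carrier (ideal_unitization I)" if "x \<in> I" for x
      using that unfolding ideal_unitization_def by (auto intro!: exI[of _ 1] exI[of _ x] simp: U.scale_one)
    have prod: "umult (?one + emb (a - e)) (?one + emb (b - e)) = ?one"
      if "a \<in> I" "b \<in> I" "a * b = e" for a b
    proof -
      have "umult (?one + emb (a - e)) (?one + emb (b - e)) =
          ?one + emb ((b - e) + (a - e) + (a - e) * (b - e))"
        by (simp add: umult_add_left umult_add_right one_left one_right emb_carrier umult_emb emb_add
            add.assoc)
      also have "(b - e) + (a - e) + (a - e) * (b - e) = 0"
        using that e by (simp add: algebra_simps)
      finally show ?thesis by (simp add: emb_def zero_prod_def[symmetric])
    qed
    have ge: "g - e \<in> I" "h - e \<in> I"
      using sub gh e(1) by (simp_all add: C.subspace_diff)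
    show "u \<in> GL_ideal I"
      unfolding GL_ideal_def Units_def fields
      using mem[OF ge(1)] mem[OF ge(2)] prod[OF gh(1,2,3)] prod[OF gh(2,1,4)] ge(1) u
      by blast
  qed
qed

lemma continuous_umult: "continuous_on S (umult (u :: 'a::cstar_algebra \<times> complex))"
proof -
  interpret C: vector_space "(*\<^sub>C) :: complex \<Rightarrow> 'a \<Rightarrow> 'a"
    by (rule vector_space_scaleC)
  have swap: "c *\<^sub>C r *\<^sub>R x = r *\<^sub>R c *\<^sub>C x" for c r and x :: 'a
    by (simp flip: scaleC_of_real add: scaleC_scaleC mult.commute)
  have 1: "bounded_linear (\<lambda>x::'a. c *\<^sub>C x)" for c
    by (rule bounded_linear_intro[of _ "cmod c"])
       (simp_all add: scaleC_add_right swap norm_scaleC mult.commute)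
  have 2: "bounded_linear (\<lambda>c. c *\<^sub>C x)" for x :: 'a
    by (rule bounded_linear_intro[of _ "norm x"])
       (simp_all add: scaleC_add_left norm_scaleC flip: scaleC_of_real,
        simp add: scaleC_scaleC scaleR_conv_of_real)
  show ?thesis
    unfolding umult_def
    by (intro continuous_on_Pair continuous_on_add continuous_on_mult continuous_on_const
        continuous_on_fst continuous_on_snd continuous_on_id
        bounded_linear.continuous_on[OF 1] bounded_linear.continuous_on[OF 2])
qed

lemma group_G_A: "group (G_A :: ('a::cstar_algebra \<times> complex) monoid)"
proof -
  interpret M: monoid "unitization :: ('a \<times> complex) monoid"
    by (rule monoid_unitization)
  let ?one = "\<one>\<^bsub>unitization :: ('a \<times> complex) monoid\<^esub>"
  let ?C = "connected_component_set GL ?one"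
  have one_GL: "?one \<in> GL"
    by (simp add: GL_iff)
  have mult_GL: "umult u v \<in> GL" if "u \<in> GL" "v \<in> GL" for u v :: "'a \<times> complex"
    using that M.Units_m_closed[of u v] by (auto simp: GL_iff snd_umult snd_one_unitization)
  have inv_GL: "\<exists>v\<in>GL. umult u v = ?one \<and> umult v u = ?one" if "u \<in> GL" for u :: "'a \<times> complex"
  proof -
    have u: "u \<in> Units unitization" "snd u = snd ?one"
      using that by (auto simp: GL_iff)
    let ?v = "inv\<^bsub>unitization\<^esub> u"
    have v: "?v \<in> Units unitization" "umult u ?v = ?one" "umult ?v u = ?one"
      using u M.Units_inv_Units M.Units_r_inv M.Units_l_inv by simp_all
    have "snd u * snd ?v = snd ?one"
      using v(2) by (metis snd_umult)
    then have "snd ?v = snd ?one"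
      using u(2) v(1) by (auto simp: snd_one_unitization Units_def carrier_unitization split: if_splits)
    then show ?thesis
      using v by (auto simp: GL_iff)
  qed
  have C_GL: "?C \<subseteq> GL"
    by (rule connected_component_subset)
  have one_C: "?one \<in> ?C"
    using one_GL by simp
  have translate: "umult u ` ?C \<subseteq> ?C" if u: "u \<in> GL" "?one \<in> umult u ` ?C" for u :: "'a \<times> complex"
  proof (rule connected_component_maximal[OF u(2)])
    show "connected (umult u ` ?C)"
      by (intro connected_continuous_image continuous_umult connected_connected_component)
    show "umult u ` ?C \<subseteq> GL"
      using mult_GL[OF u(1)] C_GL by blast
  qed
  have carr: "u \<in> carrier unitization" if "u \<in> GL" for u :: "'a \<times> complex"
    using that by (auto simp: GL_iff Units_def)
  have inv_C: "\<exists>v\<in>?C. umult u v = ?one \<and> umult v u = ?one \<and> umult v ` ?C \<subseteq> ?C" if "u \<in> ?C" for u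
  proof -
    from that C_GL obtain v where v: "v \<in> GL" "umult u v = ?one" "umult v u = ?one"
      using inv_GL by blast
    have sub: "umult v ` ?C \<subseteq> ?C"
      using translate[OF v(1)] that v(3) by (metis image_eqI)
    moreover have "v = umult v ?one"
      using M.r_one[OF carr[OF v(1)]] by simp
    ultimately have "v \<in> ?C" using one_C by blast
    then show ?thesis using v sub by blast
  qed
  have mult_C: "umult u v \<in> ?C" if "u \<in> ?C" "v \<in> ?C" for u v
  proof -
    obtain w where w: "w \<in> ?C" "umult u w = ?one" "umult w u = ?one"
      using inv_C[OF \<open>u \<in> ?C\<close>] by blast
    have "?one \<in> umult u ` ?C"
      using w by (metis image_eqI)
    then show ?thesis
      using translate[of u] that C_GL by blast
  qed
  have mult_G: "monoid.mult G_A = umult" and one_G: "\<one>\<^bsub>G_A\<^esub> = ?one" and carr_G: "carrier G_A = ?C"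
    by (simp_all add: G_A_def)
  show ?thesis
  proof (rule groupI)
    fix u v w :: "'a \<times> complex"
    assume "u \<in> carrier G_A"
    then have u: "u \<in> ?C" by (simp only: carr_G)
    then show "\<one>\<^bsub>G_A\<^esub> \<otimes>\<^bsub>G_A\<^esub> u = u"
      using M.l_one[OF carr[OF subsetD[OF C_GL u]]] by (simp only: mult_G one_G mult_unitization)
    show "\<exists>v\<in>carrier G_A. v \<otimes>\<^bsub>G_A\<^esub> u = \<one>\<^bsub>G_A\<^esub>"
      using inv_C[OF u] by (auto simp only: mult_G one_G carr_G)
    show "u \<otimes>\<^bsub>G_A\<^esub> v \<otimes>\<^bsub>G_A\<^esub> w = u \<otimes>\<^bsub>G_A\<^esub> (v \<otimes>\<^bsub>G_A\<^esub> w)"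
      by (simp only: mult_G umult_assoc)
    assume "v \<in> carrier G_A"
    then show "u \<otimes>\<^bsub>G_A\<^esub> v \<in> carrier G_A"
      using mult_C[OF u] by (simp only: mult_G carr_G)
  next
    show "\<one>\<^bsub>G_A\<^esub> \<in> carrier (G_A :: ('a \<times> complex) monoid)"
      using one_C by (simp only: one_G carr_G)
  qed
qed

end

theory Submission
  imports Defs
begin

text \<open>
  A closed normal subgroup \<open>N\<close> of \<open>G\<^sub>A\<close> is studied through its tangent space
  \<open>L = {x. \<forall>t. exp (t x) \<in> N}\<close>. As for Lie groups, \<open>L\<close> is a closed real subspace which is invariant
  under conjugation, hence \<open>[A, L] \<subseteq> L\<close>. Two facts link \<open>N\<close> and \<open>L\<close>. If \<open>exp (t x) exp (- t y) \<in> N\<close> for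
  all \<open>t\<close>, then \<open>x - y \<in> L\<close> (\<open>diff_in_tangent\<close>); conversely, if \<open>x - y \<in> L\<close>, then
  \<open>exp x exp (- y) \<in> N\<close> (\<open>exp_product_in_N\<close>). Since \<open>(g, exp a) = exp (g a g\<^sup>-\<^sup>1) exp (- a)\<close>, statements about
  commutators in \<open>N\<close> translate into statements about brackets in \<open>L\<close>, and back. The exponentials
  of a closed ideal \<open>I\<close> generate \<open>G\<^sub>I\<close> (\<open>id_component_induct\<close>), so exponentials are all one has to consider.

  For a closed normal subgroup \<open>H\<close> this gives \<open>[H, A] \<subseteq> L\<close>. Herstein's identities
  show that \<open>{x. [x, A] \<subseteq> L}\<close> contains an ideal \<open>K\<close> with \<open>[L, L] \<subseteq> K\<close>. A derivation induced by an element whose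
  square vanishes modulo \<open>K\<close> vanishes modulo \<open>K\<close>, because closed ideals of a C*-algebra are semiprime;
  applied twice this yields \<open>[L, A] \<subseteq> K\<close> and \<open>[H, A] \<subseteq> K\<close>. So the ideal \<open>I\<close> generated by \<open>[H, A]\<close> satisfies
  \<open>[I, A] \<subseteq> L\<close>, and \<open>(G\<^sub>I, G\<^sub>A) \<subseteq> H\<close> follows (\<open>commutators_with_ideal_in_normal_subgroup\<close>).

  For the other inclusion let \<open>L\<close> be the tangent space of the closure of \<open>(G\<^sub>I, G\<^sub>A)\<close>. It contains
  \<open>[I, A]\<close>. If \<open>h \<in> H\<close>, then \<open>[h, a] \<in> I\<close>, and with an approximate unit \<open>u\<close> of \<open>I\<close> that almost
  commutes with \<open>a\<close> one has \<open>[h, a] \<approx> [h u, a]\<close>; so \<open>[h, a]\<close> is in the closure of \<open>[I, A]\<close>, hence in \<open>L\<close>, and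
  all commutators \<open>(h, exp a)\<close> are in the closure of \<open>(G\<^sub>I, G\<^sub>A)\<close> (\<open>commutators_of_elements_central_mod_ideal\<close>).
  The approximate units are built from averages of powers of unitaries \<open>exp (i b)\<close>, and made quasicentral
  by an orthogonality argument (\<open>quasicentral_unit\<close>).

  For the converse it suffices that \<open>g h g\<^sup>-\<^sup>1 = (h, g)\<^sup>-\<^sup>1 h\<close>, where \<open>(h, g) \<in> H\<close> by the sandwich condition.
\<close>

section \<open>The exponential function of a Banach algebra\<close>

lemma norm_power_diff_bound:
  fixes a b :: "'b::real_normed_algebra_1"
  assumes "norm a \<le> M" "norm b \<le> M"
  shows "norm (a ^ Suc n - b ^ Suc n) \<le> real (Suc n) * M ^ n * norm (a - b)"
proof (induction n)
  case 0
  then show ?case by simp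
next
  case (Suc n)
  have "0 \<le> M"
    using assms(1) norm_ge_zero order_trans by blast
  have "norm (b ^ Suc n) \<le> M ^ Suc n"
    using norm_power_ineq[of b "Suc n"] power_mono[OF assms(2), of "Suc n"] by simp
  then have 1: "norm ((a - b) * b ^ Suc n) \<le> norm (a - b) * M ^ Suc n"
    by (intro order_trans[OF norm_mult_ineq] mult_left_mono) auto
  have "norm (a * (a ^ Suc n - b ^ Suc n)) \<le> M * (real (Suc n) * M ^ n * norm (a - b))"
    using assms Suc.IH \<open>0 \<le> M\<close> by (intro order_trans[OF norm_mult_ineq] mult_mono) auto
  with 1 have "norm (a * (a ^ Suc n - b ^ Suc n) + (a - b) * b ^ Suc n) \<le>
      M * (real (Suc n) * M ^ n * norm (a - b)) + norm (a - b) * M ^ Suc n"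
    by (intro order_trans[OF norm_triangle_ineq] add_mono)
  also have "\<dots> = real (Suc (Suc n)) * M ^ Suc n * norm (a - b)"
    by (simp add: algebra_simps)
  also have "a * (a ^ Suc n - b ^ Suc n) + (a - b) * b ^ Suc n = a ^ Suc (Suc n) - b ^ Suc (Suc n)"
    by (simp add: algebra_simps)
  finally show ?case .
qed

text \<open>The function \<open>exp x - 1 - x\<close> is the sum of the terms \<open>x\<^sup>n / n!\<close> with \<open>n \<ge> 2\<close>, and the \<open>n\<close>-th
  term has the Lipschitz constant \<open>r\<^sup>n\<^sup>-\<^sup>1 / (n - 1)!\<close> on the ball of radius \<open>r\<close>.\<close>

lemma norm_exp_remainder_diff:
  fixes x y :: "'b::{real_normed_algebra_1,banach}"
  assumes r: "norm x \<le> r" "norm y \<le> r"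
  shows "norm ((exp x - 1 - x) - (exp y - 1 - y)) \<le> (exp r - 1) * norm (x - y)"
proof -
  define f where "f = (\<lambda>n. (x ^ n - y ^ n) /\<^sub>R fact n)"
  define g where "g = (\<lambda>n. (r ^ Suc n /\<^sub>R fact (Suc n)) * norm (x - y))"
  have "f sums (exp x - exp y)"
    unfolding f_def scaleR_diff_right by (intro sums_diff exp_converges)
  from sums_split_initial_segment[OF this, of 2]
  have f: "(\<lambda>n. f (n + 2)) sums ((exp x - 1 - x) - (exp y - 1 - y))"
    by (simp add: f_def numeral_2_eq_2 algebra_simps)
  have "(\<lambda>n. r ^ Suc n /\<^sub>R fact (Suc n)) sums (exp r - 1)"
    using sums_split_initial_segment[OF exp_converges[of r], of 1] by simp
  then have g: "g sums ((exp r - 1) * norm (x - y))"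
    unfolding g_def by (rule sums_mult2)
  have "norm (f (n + 2)) \<le> g n" for n
  proof -
    have "norm (f (n + 2)) = norm (x ^ Suc (Suc n) - y ^ Suc (Suc n)) / fact (Suc (Suc n))"
      by (simp add: f_def divide_inverse mult.commute)
    also have "\<dots> \<le> (real (Suc (Suc n)) * r ^ Suc n * norm (x - y)) / fact (Suc (Suc n))"
      by (intro divide_right_mono norm_power_diff_bound r) auto
    also have "\<dots> = g n"
      by (simp add: g_def divide_inverse fact_Suc[of "Suc n"] del: of_nat_Suc)
    finally show ?thesis .
  qed
  then have "norm (\<Sum>n. f (n + 2)) \<le> (\<Sum>n. g n)"
    using g by (intro norm_suminf_le) (auto simp: sums_iff)
  then show ?thesis
    using f g by (simp add: sums_iff)
qed

lemma tendsto_exp_algebra: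
  fixes f :: "'c \<Rightarrow> 'b::{real_normed_algebra_1,banach}"
  assumes "(f \<longlongrightarrow> x) F"
  shows "((\<lambda>n. exp (f n)) \<longlongrightarrow> exp x) F"
proof -
  define r where "r = norm x + 1"
  have bound: "norm (exp u - exp x) \<le> exp r * norm (u - x)" if "norm u \<le> r" for u
  proof -
    have "norm (exp u - exp x) = norm (((exp u - 1 - u) - (exp x - 1 - x)) + (u - x))"
      by (simp add: algebra_simps)
    also have "\<dots> \<le> (exp r - 1) * norm (u - x) + norm (u - x)"
      using norm_exp_remainder_diff[of u r x] that
      by (intro order_trans[OF norm_triangle_ineq] add_right_mono) (simp add: r_def)
    finally show ?thesis by (simp add: algebra_simps)
  qed
  have "\<forall>\<^sub>F n in F. norm (f n) < r"
    using tendsto_norm[OF assms] by (rule order_tendstoD) (simp add: r_def)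
  then have ev: "\<forall>\<^sub>F n in F. norm (exp (f n) - exp x) \<le> exp r * norm (f n - x)"
    by eventually_elim (simp add: bound)
  have "((\<lambda>n. exp r * norm (f n - x)) \<longlongrightarrow> exp r * norm (x - x)) F"
    by (intro tendsto_intros assms)
  then have "((\<lambda>n. exp (f n) - exp x) \<longlongrightarrow> 0) F"
    by (intro Lim_null_comparison[OF ev]) simp
  then show ?thesis
    by (simp add: LIM_zero_iff)
qed

lemma exp_power:
  fixes x :: "'b::{real_normed_algebra_1,banach}"
  shows "exp x ^ n = exp (real n *\<^sub>R x)"
proof (induction n)
  case (Suc n)
  have "exp (x + real n *\<^sub>R x) = exp x * exp (real n *\<^sub>R x)"
    by (rule exp_add_commuting) simp
  then show ?case
    by (simp add: Suc.IH scaleR_add_left)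
qed simp

lemma exp_difference_quotient:
  fixes x :: "'b::{real_normed_algebra_1,banach}"
  shows "(\<lambda>n. real (Suc n) *\<^sub>R (exp (x /\<^sub>R real (Suc n)) - 1)) \<longlonglongrightarrow> x"
proof -
  have "((\<lambda>t. exp (t *\<^sub>R x)) has_vector_derivative exp (0 *\<^sub>R x) * x) (at 0)"
    by (rule exp_scaleR_has_vector_derivative_right)
  then have *: "((\<lambda>t. norm (exp (t *\<^sub>R x) - 1 - t *\<^sub>R x) / norm t) \<longlongrightarrow> 0) (at 0)"
    by (simp add: has_vector_derivative_def has_derivative_iff_norm)
  have "((\<lambda>t. (exp (t *\<^sub>R x) - 1) /\<^sub>R t - x) \<longlongrightarrow> 0) (at 0)"
  proof (rule Lim_null_comparison[OF _ *])
    show "\<forall>\<^sub>F t in at 0. norm ((exp (t *\<^sub>R x) - 1) /\<^sub>R t - x) \<le> norm (exp (t *\<^sub>R x) - 1 - t *\<^sub>R x) / norm t"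
    proof (rule eventually_at_topological[THEN iffD2, OF exI[of _ UNIV]], safe)
      fix t :: real assume "t \<noteq> 0"
      then have "(exp (t *\<^sub>R x) - 1) /\<^sub>R t - x = (exp (t *\<^sub>R x) - 1 - t *\<^sub>R x) /\<^sub>R t"
        by (simp add: scaleR_diff_right)
      then show "norm ((exp (t *\<^sub>R x) - 1) /\<^sub>R t - x) \<le> norm (exp (t *\<^sub>R x) - 1 - t *\<^sub>R x) / norm t"
        by (simp add: divide_inverse)
    qed auto
  qed
  then have "((\<lambda>t. (exp (t *\<^sub>R x) - 1) /\<^sub>R t) \<longlongrightarrow> x) (at 0)"
    by (simp add: LIM_zero_iff)
  moreover have "filterlim (\<lambda>n. inverse (real (Suc n))) (at 0) sequentially"
    using LIMSEQ_inverse_real_of_nat by (simp add: filterlim_at)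
  ultimately have "(\<lambda>n. (exp (inverse (real (Suc n)) *\<^sub>R x) - 1) /\<^sub>R inverse (real (Suc n))) \<longlonglongrightarrow> x"
    by (rule filterlim_compose)
  then show ?thesis by simp
qed

text \<open>Both \<open>c\<^sub>n\<close> and \<open>exp (v / n)\<close> equal \<open>1 + v / n + o(1 / n)\<close>, so their norms are
  \<open>1 + O(1 / n)\<close> and their \<open>n\<close>-th powers differ by \<open>o(1)\<close>.\<close>

lemma power_tendsto_exp:
  fixes c :: "nat \<Rightarrow> 'b::{real_normed_algebra_1,banach}"
  assumes c: "(\<lambda>n. real (Suc n) *\<^sub>R (c n - 1)) \<longlonglongrightarrow> v"
  shows "(\<lambda>n. c n ^ Suc n) \<longlonglongrightarrow> exp v"
proof -
  define e where "e = (\<lambda>n. exp (v /\<^sub>R real (Suc n)))"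
  have e: "(\<lambda>n. real (Suc n) *\<^sub>R (e n - 1)) \<longlonglongrightarrow> v"
    unfolding e_def by (rule exp_difference_quotient)
  obtain K1 where K1: "\<And>n. norm (real (Suc n) *\<^sub>R (c n - 1)) \<le> K1"
    using c convergent_imp_Bseq[of "\<lambda>n. real (Suc n) *\<^sub>R (c n - 1)"]
    by (auto simp: convergent_def Bseq_def)
  obtain K2 where K2: "\<And>n. norm (real (Suc n) *\<^sub>R (e n - 1)) \<le> K2"
    using e convergent_imp_Bseq[of "\<lambda>n. real (Suc n) *\<^sub>R (e n - 1)"]
    by (auto simp: convergent_def Bseq_def)
  define K where "K = max K1 K2"
  have "0 \<le> K"
    using order_trans[OF norm_ge_zero K1[of 0]] by (simp add: K_def)
  have bound: "norm u \<le> 1 + K / real (Suc n)" if "norm (real (Suc n) *\<^sub>R (u - 1)) \<le> K" for n and u :: 'b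
  proof -
    have "real (Suc n) * norm (u - 1) \<le> K"
      using that by simp
    then have "norm (u - 1) \<le> K / real (Suc n)"
      by (simp add: pos_le_divide_eq mult.commute)
    then show ?thesis
      using norm_triangle_ineq[of "u - 1" 1] by simp
  qed
  have pow: "(1 + K / real (Suc n)) ^ Suc n \<le> exp K" for n
  proof -
    have "(1 + K / real (Suc n)) ^ Suc n \<le> exp (K / real (Suc n)) ^ Suc n"
      using \<open>0 \<le> K\<close> by (intro power_mono) auto
    also have "\<dots> = exp K"
      by (simp del: of_nat_Suc power_Suc flip: exp_of_nat_mult)
    finally show ?thesis .
  qed
  have le: "norm (c n ^ Suc n - exp v) \<le> exp K *
      norm (real (Suc n) *\<^sub>R (c n - 1) - real (Suc n) *\<^sub>R (e n - 1))" for n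
  proof -
    have "e n ^ Suc n = exp v"
      by (simp add: e_def exp_power del: of_nat_Suc power_Suc)
    moreover have "norm (c n) \<le> 1 + K / real (Suc n)" "norm (e n) \<le> 1 + K / real (Suc n)"
      using bound[of n "c n"] bound[of n "e n"] K1[of n] K2[of n] by (auto simp: K_def)
    ultimately have "norm (c n ^ Suc n - exp v) \<le>
        real (Suc n) * (1 + K / real (Suc n)) ^ n * norm (c n - e n)"
      using norm_power_diff_bound[of "c n" "1 + K / real (Suc n)" "e n" n] by simp
    also have "\<dots> \<le> real (Suc n) * (1 + K / real (Suc n)) ^ Suc n * norm (c n - e n)"
      using \<open>0 \<le> K\<close> by (intro mult_right_mono mult_left_mono power_increasing) auto
    also have "\<dots> \<le> real (Suc n) * exp K * norm (c n - e n)"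
      using pow by (intro mult_right_mono mult_left_mono) auto
    also have "\<dots> = exp K * norm (real (Suc n) *\<^sub>R (c n - 1) - real (Suc n) *\<^sub>R (e n - 1))"
    proof -
      have "real (Suc n) *\<^sub>R (c n - 1) - real (Suc n) *\<^sub>R (e n - 1) = real (Suc n) *\<^sub>R (c n - e n)"
        by (simp only: scaleR_diff_right) simp
      then show ?thesis by simp
    qed
    finally show ?thesis .
  qed
  have "(\<lambda>n. exp K * norm (real (Suc n) *\<^sub>R (c n - 1) - real (Suc n) *\<^sub>R (e n - 1)))
      \<longlonglongrightarrow> exp K * norm (v - v)"
    by (intro tendsto_intros c e)
  then have "(\<lambda>n. c n ^ Suc n - exp v) \<longlonglongrightarrow> 0"
    by (intro Lim_null_comparison[OF always_eventually[OF allI[OF le]]]) (simp only: diff_self norm_zero mult_zero_right)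
  then show ?thesis
    by (simp add: LIM_zero_iff)
qed

lemma exp_product_difference_quotient:
  fixes x y :: "'b::{real_normed_algebra_1,banach}"
  shows "(\<lambda>n. real (Suc n) *\<^sub>R (exp (x /\<^sub>R real (Suc n)) * exp (y /\<^sub>R real (Suc n)) - 1)) \<longlonglongrightarrow> x + y"
proof -
  have "(\<lambda>n. exp (y /\<^sub>R real (Suc n))) \<longlonglongrightarrow> exp (0 *\<^sub>R y)"
    by (intro tendsto_exp_algebra tendsto_scaleR LIMSEQ_inverse_real_of_nat tendsto_const)
  then have "(\<lambda>n. (real (Suc n) *\<^sub>R (exp (x /\<^sub>R real (Suc n)) - 1)) * exp (y /\<^sub>R real (Suc n)) +
      real (Suc n) *\<^sub>R (exp (y /\<^sub>R real (Suc n)) - 1)) \<longlonglongrightarrow> x * exp (0 *\<^sub>R y) + y"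
    by (intro tendsto_intros exp_difference_quotient)
  then show ?thesis
    by (simp add: algebra_simps)
qed

lemma exp_conj:
  fixes g k x :: "'b::{real_normed_algebra_1,banach}"
  assumes "g * k = 1" "k * g = 1"
  shows "exp (g * x * k) = g * exp x * k"
proof -
  have pow: "(g * x * k) ^ n = g * x ^ n * k" for n
  proof (induction n)
    case (Suc n)
    have "(g * x * k) ^ Suc n = (g * x * k) * (g * x ^ n * k)"
      by (simp only: power_Suc Suc.IH)
    also have "\<dots> = g * x * (k * g) * x ^ n * k"
      by (simp only: mult.assoc)
    finally show ?case
      by (simp add: assms(2) mult.assoc)
  qed (simp add: assms(1))
  have "(\<lambda>n. g * (x ^ n /\<^sub>R fact n) * k) sums (g * exp x * k)"
    by (intro sums_mult sums_mult2 exp_converges)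
  then have "(\<lambda>n. (g * x * k) ^ n /\<^sub>R fact n) sums (g * exp x * k)"
    by (simp add: pow)
  then show ?thesis
    using exp_converges sums_unique2 by blast
qed

lemma exp_minus_inverse': "exp (- x) * exp (x::'b::{real_normed_algebra_1,banach}) = 1"
  using exp_minus_inverse[of "- x"] by simp

lemma exp_minus_one_in_ideal:
  fixes A :: "'b::{real_normed_algebra_1,banach} set"
  assumes A: "subspace A" "closed A" and left: "\<And>u x. x \<in> A \<Longrightarrow> u * x \<in> A" and x: "x \<in> A"
  shows "exp x - 1 \<in> A"
proof -
  have "(\<lambda>n. x ^ Suc n /\<^sub>R fact (Suc n)) sums (exp x - 1)"
    using sums_split_initial_segment[OF exp_converges[of x], of 1] by simp
  then have lim: "(\<lambda>n. \<Sum>k<n. x ^ Suc k /\<^sub>R fact (Suc k)) \<longlonglongrightarrow> exp x - 1"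
    by (simp only: sums_def)
  have "x ^ Suc k \<in> A" for k
    unfolding power_Suc2 by (intro left x)
  then have "(\<Sum>k<n. x ^ Suc k /\<^sub>R fact (Suc k)) \<in> A" for n
    by (intro subspace_sum subspace_scale A)
  then show ?thesis
    using lim by (rule closed_sequentially[OF A(2)])
qed

text \<open>The equation \<open>exp y = 1 + z\<close> is solved by iterating the contraction \<open>y \<mapsto> z - (exp y - 1 - y)\<close>.\<close>

lemma local_logarithm:
  fixes A :: "'b::{real_normed_algebra_1,banach} set"
  assumes A: "subspace A" "closed A" and left: "\<And>u x. x \<in> A \<Longrightarrow> u * x \<in> A"
  obtains \<delta> where "0 < \<delta>" "\<And>z. z \<in> A \<Longrightarrow> norm z < \<delta> \<Longrightarrow> \<exists>y\<in>A. exp y = 1 + z"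
proof -
  \<comment> \<open>chosen so that the Lipschitz constant \<open>exp r - 1\<close> is \<open>1 / 2\<close>\<close>
  define r :: real where "r = ln (3 / 2)"
  have r: "0 < r" "exp r - 1 = 1 / 2"
    by (simp_all add: r_def)
  have "\<exists>y\<in>A. exp y = 1 + z" if z: "z \<in> A" "norm z < r / 2" for z
  proof -
    define f where "f = (\<lambda>y. z - (exp y - 1 - y))"
    have lip: "dist (f x) (f y) \<le> 1 / 2 * dist x y" if "x \<in> A \<inter> cball 0 r" "y \<in> A \<inter> cball 0 r" for x y
    proof -
      have "f x - f y = - ((exp x - 1 - x) - (exp y - 1 - y))"
        by (simp add: f_def)
      then have "dist (f x) (f y) = norm ((exp x - 1 - x) - (exp y - 1 - y))"
        by (simp only: dist_norm norm_minus_cancel)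
      then show ?thesis
        using norm_exp_remainder_diff[of x r y] that r(2) by (simp add: dist_norm)
    qed
    have "\<exists>!y\<in>A \<inter> cball 0 r. f y = y"
    proof (rule Banach_fix[where c = "1 / 2"])
      show "complete (A \<inter> cball 0 r)"
        using A by (simp add: complete_eq_closed closed_Int)
      show "A \<inter> cball 0 r \<noteq> {}"
        using A r subspace_0[of A] by auto
      show "f ` (A \<inter> cball 0 r) \<subseteq> A \<inter> cball 0 r"
      proof safe
        fix y assume y: "y \<in> A" "y \<in> cball 0 r"
        have "exp y - 1 \<in> A"
          by (rule exp_minus_one_in_ideal[OF A left y(1)])
        then show "f y \<in> A"
          unfolding f_def using A(1) y(1) z(1) by (simp add: subspace_diff del: diff_diff_eq)
        have "0 \<in> A \<inter> cball 0 r"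
          using A r subspace_0[of A] by auto
        then have "dist (f y) (f 0) \<le> 1 / 2 * dist y 0"
          using y by (intro lip) auto
        then have "norm (f y - z) \<le> r / 2"
          using y by (simp add: f_def dist_norm)
        then show "f y \<in> cball 0 r"
          using z(2) norm_triangle_ineq[of "f y - z" z] by simp
      qed
    qed (use lip in auto)
    then obtain y where "y \<in> A" "f y = y"
      by auto
    then show ?thesis
      by (intro bexI[of _ y]) (simp_all add: f_def algebra_simps)
  qed
  then show thesis
    using r(1) by (intro that[of "r / 2"]) auto
qed

section \<open>Closed normal subgroups of invertibles and their tangent spaces\<close>

locale closed_normal_subgroup =
  fixes A G N :: "'b::{real_normed_algebra_1,banach} set"
  assumes subspace_A: "subspace A" and closed_A: "closed A"
    and left_A: "x \<in> A \<Longrightarrow> u * x \<in> A" and right_A: "x \<in> A \<Longrightarrow> x * u \<in> A"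
    and exp_G: "x \<in> A \<Longrightarrow> exp x \<in> G" and mult_G: "g \<in> G \<Longrightarrow> h \<in> G \<Longrightarrow> g * h \<in> G"
    and one_N: "1 \<in> N" and mult_N: "g \<in> N \<Longrightarrow> h \<in> N \<Longrightarrow> g * h \<in> N"
    and conj_N: "h \<in> N \<Longrightarrow> g \<in> G \<Longrightarrow> k \<in> G \<Longrightarrow> g * k = 1 \<Longrightarrow> k * g = 1 \<Longrightarrow> g * h * k \<in> N"
    and lim_N: "(\<And>n. f n \<in> N) \<Longrightarrow> f \<longlonglongrightarrow> z \<Longrightarrow> z \<in> G \<Longrightarrow> z \<in> N"
begin

text \<open>The analogue of the Lie algebra of a closed subgroup.\<close>

definition tangent :: "'b set" where
  "tangent = {x \<in> A. \<forall>t. exp (t *\<^sub>R x) \<in> N}"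

lemma power_N: "c \<in> N \<Longrightarrow> c ^ n \<in> N"
  by (induction n) (auto intro: one_N mult_N)

lemma exp_in_N_of_difference_quotient:
  assumes "\<And>n. c n \<in> N" "v \<in> A" "(\<lambda>n. real (Suc n) *\<^sub>R (c n - 1)) \<longlonglongrightarrow> v"
  shows "exp v \<in> N"
  using lim_N[OF power_N[OF assms(1)] power_tendsto_exp[OF assms(3)] exp_G[OF assms(2)]] .

lemma exp_tangent: "x \<in> tangent \<Longrightarrow> exp (t *\<^sub>R x) \<in> N"
  by (simp add: tangent_def)

lemma tangent_A: "x \<in> tangent \<Longrightarrow> x \<in> A"
  by (simp add: tangent_def)

text \<open>Every curve in \<open>N\<close> of the form \<open>exp (t x) exp (- t y)\<close> has its velocity at \<open>t = 0\<close> in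
  the tangent space, because \<open>exp (t (x - y))\<close> is the limit of the \<open>n\<close>-th powers of its
  value at \<open>t / n\<close>.\<close>

lemma diff_in_tangent:
  assumes "x \<in> A" "y \<in> A" and N: "\<And>t. exp (t *\<^sub>R x) * exp (- (t *\<^sub>R y)) \<in> N"
  shows "x - y \<in> tangent"
proof -
  have A: "t *\<^sub>R (x - y) \<in> A" for t
    using assms subspace_A by (simp add: subspace_diff subspace_scale)
  have "exp (t *\<^sub>R (x - y)) \<in> N" for t
  proof (rule exp_in_N_of_difference_quotient[OF _ A])
    show "exp ((t *\<^sub>R x) /\<^sub>R real (Suc n)) * exp ((- (t *\<^sub>R y)) /\<^sub>R real (Suc n)) \<in> N" for n
      using N[of "t / real (Suc n)"] by (simp add: divide_inverse mult.commute)
    show "(\<lambda>n. real (Suc n) *\<^sub>R (exp ((t *\<^sub>R x) /\<^sub>R real (Suc n)) * exp ((- (t *\<^sub>R y)) /\<^sub>R real (Suc n)) - 1))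
        \<longlonglongrightarrow> t *\<^sub>R (x - y)"
      using exp_product_difference_quotient[of "t *\<^sub>R x" "- (t *\<^sub>R y)"] by (simp add: scaleR_diff_right)
  qed
  then show ?thesis
    using A[of 1] by (simp add: tangent_def)
qed

lemma subspace_tangent: "subspace tangent"
proof (rule subspaceI)
  show "0 \<in> tangent"
    using subspace_A one_N by (simp add: tangent_def subspace_0)
  show scale: "c *\<^sub>R x \<in> tangent" if "x \<in> tangent" for c x
    using that subspace_A by (simp add: tangent_def subspace_scale)
  show "x + y \<in> tangent" if xy: "x \<in> tangent" "y \<in> tangent" for x y
  proof -
    have "- y \<in> A"
      using xy tangent_A subspace_A subspace_neg by blast
    moreover have "exp (t *\<^sub>R x) * exp (- (t *\<^sub>R - y)) \<in> N" for t
      using xy by (simp add: mult_N exp_tangent)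
    ultimately show ?thesis
      using diff_in_tangent[of x "- y"] xy tangent_A by simp
  qed
qed

lemma closed_tangent: "closed tangent"
  unfolding closed_sequential_limits
proof (intro allI impI, elim conjE)
  fix f l assume f: "\<forall>n. f n \<in> tangent" "f \<longlonglongrightarrow> l"
  then have l: "l \<in> A"
    using closed_A tangent_A unfolding closed_sequential_limits by blast
  have "exp (t *\<^sub>R l) \<in> N" for t
  proof (rule lim_N)
    show "exp (t *\<^sub>R f n) \<in> N" for n
      using f by (simp add: exp_tangent)
    show "(\<lambda>n. exp (t *\<^sub>R f n)) \<longlonglongrightarrow> exp (t *\<^sub>R l)"
      using f by (intro tendsto_exp_algebra tendsto_scaleR tendsto_const)
    show "exp (t *\<^sub>R l) \<in> G"
      using l subspace_A by (simp add: exp_G subspace_scale)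
  qed
  with l show "l \<in> tangent"
    by (simp add: tangent_def)
qed

lemma conj_tangent:
  assumes "x \<in> tangent" "g \<in> G" "k \<in> G" "g * k = 1" "k * g = 1"
  shows "g * x * k \<in> tangent"
proof -
  have "exp (t *\<^sub>R (g * x * k)) = g * exp (t *\<^sub>R x) * k" for t
    using exp_conj[OF assms(4,5), of "t *\<^sub>R x"] by simp
  then show ?thesis
    using assms left_A right_A by (simp add: tangent_def conj_N)
qed

lemma exp_inverse_G:
  assumes "a \<in> A"
  shows "exp a \<in> G" "exp (- a) \<in> G" "exp a * exp (- a) = 1" "exp (- a) * exp a = 1"
  using assms exp_G subspace_A subspace_neg exp_minus_inverse exp_minus_inverse' by blast+

text \<open>The tangent space is invariant under conjugation by \<open>exp (a / n)\<close>, hence under the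
  derivative of these conjugations, which is the bracket with \<open>a\<close>.\<close>

lemma bracket_tangent:
  assumes "x \<in> tangent" "a \<in> A"
  shows "a * x - x * a \<in> tangent"
proof -
  define q where "q = (\<lambda>n. exp (a /\<^sub>R real (Suc n)))"
  define q' where "q' = (\<lambda>n. exp ((- a) /\<^sub>R real (Suc n)))"
  have aA: "a /\<^sub>R real (Suc n) \<in> A" for n
    using assms subspace_A by (simp add: subspace_scale)
  have "real (Suc n) *\<^sub>R (q n * x * q' n - x) \<in> tangent" for n
    unfolding q_def q'_def using conj_tangent[OF assms(1), of "exp (a /\<^sub>R real (Suc n))" "exp (- (a /\<^sub>R real (Suc n)))"]
      exp_inverse_G[OF aA, of n] assms(1) subspace_tangent
    by (simp add: subspace_scale subspace_diff del: of_nat_Suc)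
  moreover have "(\<lambda>n. real (Suc n) *\<^sub>R (q n * x * q' n - x)) \<longlonglongrightarrow> a * x - x * a"
  proof -
    have "q' \<longlonglongrightarrow> exp (0 *\<^sub>R (- a))"
      unfolding q'_def by (intro tendsto_exp_algebra tendsto_scaleR LIMSEQ_inverse_real_of_nat tendsto_const)
    then have "(\<lambda>n. (real (Suc n) *\<^sub>R (q n - 1)) * x * q' n + x * (real (Suc n) *\<^sub>R (q' n - 1)))
        \<longlonglongrightarrow> a * x * exp (0 *\<^sub>R (- a)) + x * (- a)"
      unfolding q_def q'_def by (intro tendsto_intros exp_difference_quotient)
    then show ?thesis
      by (simp add: algebra_simps)
  qed
  ultimately show ?thesis
    by (rule closed_sequentially[OF closed_tangent])
qed

text \<open>With \<open>p = exp (x / n)\<close> and \<open>q = exp (- y / n)\<close>, the telescoping identity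
  \<open>p\<^sup>n q\<^sup>n = (p\<^sup>n\<^sup>-\<^sup>1 (p q) p\<^sup>-\<^sup>(\<^sup>n\<^sup>-\<^sup>1\<^sup>)) \<dots> (p (p q) p\<^sup>-\<^sup>1) (p q)\<close> writes \<open>exp x exp (- y)\<close> as a
  product of \<open>n\<close> conjugates of \<open>p q\<close>. Replacing each \<open>p q\<close> by \<open>exp ((x - y) / n) \<in> N\<close>, which
  differs from it by \<open>o(1 / n)\<close>, changes the whole product by \<open>o(1)\<close>.\<close>

lemma exp_product_in_N:
  assumes x: "x \<in> A" and y: "y \<in> A" and xy: "x - y \<in> tangent"
  shows "exp x * exp (- y) \<in> N"
proof -
  define M where "M = exp (norm x + norm y)"
  define p where "p = (\<lambda>n. exp (x /\<^sub>R real (Suc n)))"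
  define q where "q = (\<lambda>n. exp ((- y) /\<^sub>R real (Suc n)))"
  define f where "f = (\<lambda>n. exp ((x - y) /\<^sub>R real (Suc n)))"
  define P where "P = (\<lambda>n k. exp ((real k / real (Suc n)) *\<^sub>R x))"
  define P' where "P' = (\<lambda>n k. exp (- ((real k / real (Suc n)) *\<^sub>R x)))"
  define Q where "Q = (\<lambda>n k. exp ((real k / real (Suc n)) *\<^sub>R (- y)))"
  \<comment> \<open>the product \<open>P n k * Q n k = p\<^sup>k q\<^sup>k\<close> with each factor \<open>p q\<close> replaced by \<open>f n\<close>\<close>
  define w where "w = (\<lambda>n. rec_nat 1 (\<lambda>k u. P n k * f n * P' n k * u))"
  have w_Suc: "w n (Suc k) = P n k * f n * P' n k * w n k" and w_0: "w n 0 = 1" for n k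
    by (simp_all add: w_def)
  have PP': "P n k * P' n k = 1" "P' n k * P n k = 1" for n k
    by (simp_all add: P_def P'_def exp_minus_inverse exp_minus_inverse')
  have P_in_G: "P n k \<in> G" "P' n k \<in> G" for n k
    unfolding P_def P'_def using x subspace_A by (simp_all add: exp_G subspace_neg subspace_scale)
  have fN: "f n \<in> N" for n
    unfolding f_def using xy by (rule exp_tangent)
  have wN: "w n k \<in> N" for n k
    by (induction k) (auto simp: w_0 w_Suc one_N mult_N conj_N fN P_in_G PP')
  have step: "(real (Suc k) / real (Suc n)) *\<^sub>R u = (real k / real (Suc n)) *\<^sub>R u + u /\<^sub>R real (Suc n)"
    for u :: 'b and n k
    by (simp add: divide_inverse distrib_right flip: scaleR_add_left)
  have pP: "P n (Suc k) = P n k * p n" for n k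
    unfolding P_def p_def step by (rule exp_add_commuting) simp
  have qQ: "Q n (Suc k) = q n * Q n k" for n k
    unfolding Q_def q_def step add.commute[of "(real k / real (Suc n)) *\<^sub>R - y"]
    by (rule exp_add_commuting) simp
  have M1: "1 \<le> M"
    by (simp add: M_def)
  have norm_le: "norm (exp (c *\<^sub>R u)) \<le> M" if "norm u \<le> norm x + norm y" "\<bar>c\<bar> \<le> 1" for c u
  proof -
    have "\<bar>c\<bar> * norm u \<le> 1 * (norm x + norm y)"
      using that by (intro mult_mono) auto
    then show ?thesis
      unfolding M_def using order_trans[OF norm_exp[of "c *\<^sub>R u"]] by auto
  qed
  have norms: "norm (P n k) \<le> M" "norm (P' n k) \<le> M" "norm (Q n k) \<le> M" if "k \<le> n" for n k
    using that norm_le[of x "real k / real (Suc n)"] norm_le[of "- x" "real k / real (Suc n)"]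
      norm_le[of "- y" "real k / real (Suc n)"]
    by (simp_all add: P_def P'_def Q_def divide_le_eq_1)
  obtain D where D: "\<And>n. norm (real (Suc n) *\<^sub>R (f n - 1)) \<le> D"
    using exp_difference_quotient[of "x - y"] convergent_imp_Bseq[of "\<lambda>n. real (Suc n) *\<^sub>R (f n - 1)"]
    by (auto simp: convergent_def Bseq_def f_def)
  define E where "E = M * D * M"
  have "0 \<le> D"
    using order_trans[OF norm_ge_zero D[of 0]] .
  then have "0 \<le> E"
    using M1 by (simp add: E_def)
  have conj_f: "norm (P n k * f n * P' n k) \<le> 1 + E / real (Suc n)" if "k \<le> n" for n k
  proof -
    have "norm (f n - 1) \<le> D / real (Suc n)"
      using D[of n] by (simp add: pos_le_divide_eq mult.commute)
    then have "norm (P n k * (f n - 1) * P' n k) \<le> M * (D / real (Suc n)) * M"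
      using norms[OF that] M1 \<open>0 \<le> D\<close>
      by (intro order_trans[OF norm_mult_ineq] mult_mono) auto
    moreover have "P n k * f n * P' n k = P n k * (f n - 1) * P' n k + 1"
      by (simp add: algebra_simps PP')
    ultimately show ?thesis
      using norm_triangle_ineq[of "P n k * (f n - 1) * P' n k" 1] by (simp add: E_def)
  qed
  define d where "d = (\<lambda>n. norm (p n * q n - f n))"
  \<comment> \<open>each step multiplies the error by \<open>1 + E / (n + 1)\<close> at most, and adds the error \<open>d n = o(1 / n)\<close>
    of one factor\<close>
  have error: "norm (P n k * Q n k - w n k) \<le> real k * (1 + E / real (Suc n)) ^ k * (M * M * d n)"
    if "k \<le> Suc n" for n k
    using that
  proof (induction k)
    case 0
    then show ?case by (simp add: w_0 P_def Q_def)
  next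
    case (Suc k)
    define B where "B = 1 + E / real (Suc n)"
    have "1 \<le> B"
      using \<open>0 \<le> E\<close> by (simp add: B_def)
    have k: "k \<le> n"
      using Suc.prems by simp
    have split: "P n (Suc k) * Q n (Suc k) - w n (Suc k) =
        P n k * (p n * q n - f n) * Q n k + P n k * f n * P' n k * (P n k * Q n k - w n k)"
    proof -
      have "P n k * f n * P' n k * (P n k * Q n k) = P n k * f n * (P' n k * P n k) * Q n k"
        by (simp only: mult.assoc)
      then have "P n k * f n * P' n k * (P n k * Q n k) = P n k * f n * Q n k"
        by (simp add: PP')
      then show ?thesis
        by (simp add: pP qQ w_Suc right_diff_distrib left_diff_distrib) (simp add: mult.assoc)
    qed
    have "norm (P n k * (p n * q n - f n) * Q n k) \<le> M * d n * M"
      using norms[OF k] M1 by (intro order_trans[OF norm_mult_ineq] mult_mono) (auto simp: d_def)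
    moreover have "norm (P n k * f n * P' n k * (P n k * Q n k - w n k)) \<le>
        B * (real k * B ^ k * (M * M * d n))"
      using conj_f[OF k] Suc.IH k \<open>1 \<le> B\<close>
      by (intro order_trans[OF norm_mult_ineq[of "P n k * f n * P' n k"]] mult_mono) (auto simp: B_def d_def)
    ultimately have "norm (P n (Suc k) * Q n (Suc k) - w n (Suc k)) \<le>
        1 * (M * M * d n) + real k * B ^ Suc k * (M * M * d n)"
      unfolding split by (intro order_trans[OF norm_triangle_ineq]) (simp add: algebra_simps)
    also have "\<dots> \<le> B ^ Suc k * (M * M * d n) + real k * B ^ Suc k * (M * M * d n)"
      using \<open>1 \<le> B\<close> M1 one_le_power[of B "Suc k"]
      by (intro add_right_mono mult_right_mono) (auto simp: d_def)
    also have "\<dots> = real (Suc k) * B ^ Suc k * (M * M * d n)"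
      by (simp only: of_nat_Suc distrib_right mult_1)
    finally show ?case
      unfolding B_def .
  qed
  have final: "norm (exp x * exp (- y) - w n (Suc n)) \<le> exp E * (M * M) * (real (Suc n) * d n)" for n
  proof -
    have "P n (Suc n) = exp x" "Q n (Suc n) = exp (- y)"
      by (simp_all add: P_def Q_def del: of_nat_Suc)
    then have "norm (exp x * exp (- y) - w n (Suc n)) \<le>
        real (Suc n) * (1 + E / real (Suc n)) ^ Suc n * (M * M * d n)"
      using error[of "Suc n" n] by simp
    also have "(1 + E / real (Suc n)) ^ Suc n \<le> exp E"
    proof -
      have "(1 + E / real (Suc n)) ^ Suc n \<le> exp (E / real (Suc n)) ^ Suc n"
        using \<open>0 \<le> E\<close> by (intro power_mono) auto
      then show ?thesis
        by (simp add: exp_power del: of_nat_Suc power_Suc)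
    qed
    finally show ?thesis
      using M1 by (simp add: mult_left_mono mult_right_mono d_def mult_ac)
  qed
  have "(\<lambda>n. real (Suc n) *\<^sub>R (p n * q n - 1) - real (Suc n) *\<^sub>R (f n - 1)) \<longlonglongrightarrow> (x + - y) - (x - y)"
    unfolding p_def q_def f_def
    by (intro tendsto_diff exp_product_difference_quotient exp_difference_quotient)
  then have "(\<lambda>n. real (Suc n) *\<^sub>R (p n * q n - f n)) \<longlonglongrightarrow> 0"
    by (simp flip: scaleR_diff_right del: of_nat_Suc)
  from tendsto_norm_zero[OF this] have "(\<lambda>n. real (Suc n) * d n) \<longlonglongrightarrow> 0"
    by (simp add: d_def)
  then have "(\<lambda>n. exp E * (M * M) * (real (Suc n) * d n)) \<longlonglongrightarrow> exp E * (M * M) * 0"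
    by (intro tendsto_mult tendsto_const)
  then have "(\<lambda>n. exp x * exp (- y) - w n (Suc n)) \<longlonglongrightarrow> 0"
    by (intro Lim_null_comparison[OF always_eventually[OF allI[OF final]]]) (simp only: mult_zero_right)
  then have "(\<lambda>n. exp x * exp (- y) - (exp x * exp (- y) - w n (Suc n))) \<longlonglongrightarrow> exp x * exp (- y) - 0"
    by (intro tendsto_diff tendsto_const)
  then have lim: "(\<lambda>n. w n (Suc n)) \<longlonglongrightarrow> exp x * exp (- y)"
    by simp
  have "exp x * exp (- y) \<in> G"
    using x y exp_G mult_G subspace_A subspace_neg by blast
  then show ?thesis
    using lim_N[OF wN lim] by blast
qed

text \<open>The elements \<open>k a\<close> and \<open>a k\<close> are conjugate under \<open>k\<close>. Differentiating at \<open>t = 0\<close> the commutators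
  of \<open>k\<close> with \<open>exp (t a k)\<close> therefore gives the bracket \<open>[k, a]\<close> itself.\<close>

lemma bracket_in_tangent:
  assumes k: "k * k' = 1" "k' * k = 1" and N: "\<And>y. y \<in> A \<Longrightarrow> k * exp y * k' * exp (- y) \<in> N"
    and a: "a \<in> A"
  shows "k * a - a * k \<in> tangent"
proof (rule diff_in_tangent)
  show A: "k * a \<in> A" "a * k \<in> A"
    using a by (simp_all add: left_A right_A)
  fix t :: real
  have "k * (t *\<^sub>R (a * k)) * k' = t *\<^sub>R (k * a)"
    using k by (simp add: mult.assoc)
  then have "exp (t *\<^sub>R (k * a)) = k * exp (t *\<^sub>R (a * k)) * k'"
    using exp_conj[OF k, of "t *\<^sub>R (a * k)"] by (simp only:)
  then show "exp (t *\<^sub>R (k * a)) * exp (- (t *\<^sub>R (a * k))) \<in> N"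
    using N[of "t *\<^sub>R (a * k)"] A(2) subspace_A by (simp add: subspace_scale)
qed

text \<open>The commutators are \<open>exp (k a k') exp (- a)\<close> and \<open>exp a exp (- k a k')\<close>, and
  \<open>a - k a k' = [a k', k]\<close>; so one bracket in the tangent space suffices to place them in \<open>N\<close>.\<close>

lemma commutator_in_N:
  assumes k: "k * k' = 1" "k' * k = 1" and a: "a \<in> A"
    and bracket: "(a * k') * k - k * (a * k') \<in> tangent"
  shows "k * exp a * k' * exp (- a) \<in> N" "exp a * k * exp (- a) * k' \<in> N"
proof -
  have A: "k * a * k' \<in> A"
    using a by (simp add: left_A right_A)
  have eq: "(a * k') * k - k * (a * k') = a - k * a * k'"
    by (simp add: mult.assoc k)
  then have "k * a * k' - a \<in> tangent"
    using bracket subspace_neg[OF subspace_tangent bracket] by simp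
  then have "exp (k * a * k') * exp (- a) \<in> N"
    by (rule exp_product_in_N[OF A a])
  then show "k * exp a * k' * exp (- a) \<in> N"
    by (simp add: exp_conj[OF k])
  have "exp a * exp (- (k * a * k')) \<in> N"
    using bracket unfolding eq by (rule exp_product_in_N[OF a A])
  moreover have "exp (- (k * a * k')) = k * exp (- a) * k'"
    using exp_conj[OF k, of "- a"] by simp
  ultimately show "exp a * k * exp (- a) * k' \<in> N"
    by (simp add: mult.assoc)
qed

end

section \<open>Elementary facts on C*-algebras and their closed ideals\<close>

interpretation scaleC: vector_space "(*\<^sub>C) :: complex \<Rightarrow> 'a::cstar_algebra \<Rightarrow> 'a"
  by (rule vector_space_scaleC)

lemma norm_star [simp]: "norm (star x) = norm (x :: 'a::cstar_algebra)"
proof -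
  have le: "norm y \<le> norm (star y)" for y :: 'a
  proof (cases "y = 0")
    case False
    have "norm y * norm y \<le> norm (star y) * norm y"
      using norm_mult_ineq[of "star y" y] by (simp add: norm_star_mult power2_eq_square)
    with False show ?thesis by simp
  qed simp
  show ?thesis
    using le[of x] le[of "star x"] by (simp add: star_star)
qed

lemma star_scaleR: "star (r *\<^sub>R x) = r *\<^sub>R star (x :: 'a::cstar_algebra)"
  by (simp flip: scaleC_of_real add: star_scaleC)

lemma bounded_linear_star: "bounded_linear (star :: 'a::cstar_algebra \<Rightarrow> 'a)"
  by (rule bounded_linear_intro[of _ 1]) (simp_all add: star_add star_scaleR)

lemma star_diff: "star (x - y) = star x - star (y :: 'a::cstar_algebra)"
  by (rule linear_diff[OF bounded_linear.linear[OF bounded_linear_star]])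

lemma norm_mult_star: "norm (x * star x) = (norm (x :: 'a::cstar_algebra))\<^sup>2"
  using norm_star_mult[of "star x"] by (simp add: star_star)

lemma closed_idealD:
  fixes I :: "'a::cstar_algebra set"
  assumes "closed_ideal I"
  shows "0 \<in> I" "x \<in> I \<Longrightarrow> y \<in> I \<Longrightarrow> x + y \<in> I" "x \<in> I \<Longrightarrow> y \<in> I \<Longrightarrow> x - y \<in> I" "x \<in> I \<Longrightarrow> - x \<in> I"
    "x \<in> I \<Longrightarrow> c *\<^sub>C x \<in> I" "x \<in> I \<Longrightarrow> r *\<^sub>R x \<in> I" "x \<in> I \<Longrightarrow> a * x \<in> I" "x \<in> I \<Longrightarrow> x * a \<in> I" "closed I"
  using assms unfolding closed_ideal_def
  by (auto intro: scaleC.subspace_0 scaleC.subspace_add scaleC.subspace_diff scaleC.subspace_neg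
      scaleC.subspace_scale simp flip: scaleC_of_real)

lemma subspace_closed_ideal: "closed_ideal I \<Longrightarrow> subspace I"
  by (intro subspaceI) (auto dest: closed_idealD)

lemma closed_ideal_UNIV: "closed_ideal (UNIV :: 'a::cstar_algebra set)"
  by (simp add: closed_ideal_def)

lemma closed_ideal_hull: "closed_ideal (closed_ideal hull S)"
proof (rule hull_in)
  fix T :: "'a set set" assume "Ball T closed_ideal"
  then show "closed_ideal (\<Inter>T)"
    unfolding closed_ideal_def by (auto intro!: scaleC.subspace_Inter closed_Inter)
qed

section \<open>Lie ideals\<close>

definition lie_normalizer :: "'a::cstar_algebra set \<Rightarrow> 'a set" where
  "lie_normalizer L = {x. \<forall>a. x * a - a * x \<in> L}"

text \<open>For a closed Lie ideal \<open>L\<close> this is the largest ideal contained in \<open>lie_normalizer L\<close>; without a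
  unit, the four conditions do not reduce to the last one.\<close>

definition lie_core :: "'a::cstar_algebra set \<Rightarrow> 'a set" where
  "lie_core L = {x. x \<in> lie_normalizer L \<and> (\<forall>a. a * x \<in> lie_normalizer L) \<and>
     (\<forall>b. x * b \<in> lie_normalizer L) \<and> (\<forall>a b. a * x * b \<in> lie_normalizer L)}"

context
  fixes L :: "'a::cstar_algebra set"
  assumes subspace_L: "subspace L" and closed_L: "closed L"
    and bracket_L: "\<And>x a. x \<in> L \<Longrightarrow> a * x - x * a \<in> L"
begin

lemma swapped_bracket_L: "x \<in> L \<Longrightarrow> x * a - a * x \<in> L"
  using subspace_neg[OF subspace_L bracket_L, of x a] by simp

lemma L_subset_lie_normalizer: "x \<in> L \<Longrightarrow> x \<in> lie_normalizer L"
  by (simp add: lie_normalizer_def swapped_bracket_L)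

lemma lie_normalizer_diff_add:
  assumes "x \<in> lie_normalizer L" "y \<in> lie_normalizer L"
  shows "x - y \<in> lie_normalizer L" "x + y \<in> lie_normalizer L"
proof -
  have "(x - y) * a - a * (x - y) = (x * a - a * x) - (y * a - a * y)"
    "(x + y) * a - a * (x + y) = (x * a - a * x) + (y * a - a * y)" for a
    by (simp_all add: algebra_simps)
  then show "x - y \<in> lie_normalizer L" "x + y \<in> lie_normalizer L"
    using assms subspace_L by (simp_all add: lie_normalizer_def subspace_diff subspace_add)
qed

lemma lie_normalizer_scaleC:
  assumes "x \<in> lie_normalizer L"
  shows "c *\<^sub>C x \<in> lie_normalizer L"
proof -
  have "(c *\<^sub>C x) * a - a * (c *\<^sub>C x) = x * (c *\<^sub>C a) - (c *\<^sub>C a) * x" for a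
    by (simp add: mult_scaleC_left mult_scaleC_right)
  then show ?thesis
    using assms by (simp add: lie_normalizer_def)
qed

lemma lie_normalizer_bracket:
  assumes "x \<in> lie_normalizer L"
  shows "a * x - x * a \<in> lie_normalizer L"
proof -
  have "x * a - a * x \<in> lie_normalizer L"
    using assms by (intro L_subset_lie_normalizer) (simp add: lie_normalizer_def)
  moreover have "0 \<in> lie_normalizer L"
    using subspace_L by (simp add: lie_normalizer_def subspace_0)
  ultimately have "0 - (x * a - a * x) \<in> lie_normalizer L"
    by (rule lie_normalizer_diff_add(1)[rotated])
  then show ?thesis by simp
qed

lemma closed_lie_normalizer: "closed (lie_normalizer L)"
proof -
  have "lie_normalizer L = (\<Inter>a. (\<lambda>x. x * a - a * x) -` L)"
    by (auto simp: lie_normalizer_def)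
  moreover have "closed ((\<lambda>x. x * a - a * x) -` L)" for a
    by (intro closed_vimage closed_L continuous_intros)
  ultimately show ?thesis by auto
qed

text \<open>Since \<open>[l m, a] = [l, m a] + [m, a l]\<close>, products of two elements of \<open>L\<close> still
  normalize \<open>L\<close>.\<close>

lemma lie_normalizer_mult:
  assumes "l \<in> L" "m \<in> L"
  shows "l * m \<in> lie_normalizer L"
proof -
  have "l * m * a - a * (l * m) = (l * (m * a) - m * a * l) + (m * (a * l) - a * l * m)" for a
    by (simp add: algebra_simps)
  then show ?thesis
    using assms by (simp add: lie_normalizer_def subspace_add[OF subspace_L] swapped_bracket_L)
qed

lemma closed_ideal_lie_core: "closed_ideal (lie_core L)"
  unfolding closed_ideal_def
proof (intro conjI allI ballI)
  have zero: "0 \<in> lie_normalizer L"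
    using subspace_L by (simp add: lie_normalizer_def subspace_0)
  show "scaleC.subspace (lie_core L)"
    unfolding scaleC.subspace_def lie_core_def
    by (auto simp: zero lie_normalizer_diff_add lie_normalizer_scaleC mult_scaleC_left mult_scaleC_right
        distrib_left distrib_right)
  show "a * x \<in> lie_core L" "x * a \<in> lie_core L" if "x \<in> lie_core L" for a x
    using that by (simp_all add: lie_core_def flip: mult.assoc) (simp_all add: mult.assoc)
  have "lie_core L = lie_normalizer L \<inter> (\<Inter>a. (\<lambda>x. a * x) -` lie_normalizer L) \<inter>
      (\<Inter>b. (\<lambda>x. x * b) -` lie_normalizer L) \<inter> (\<Inter>a. \<Inter>b. (\<lambda>x. a * x * b) -` lie_normalizer L)"
    by (auto simp: lie_core_def)
  moreover have "closed \<dots>"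
    by (intro closed_Int closed_INT ballI closed_vimage closed_lie_normalizer continuous_intros)
  ultimately show "closed (lie_core L)"
    by simp
qed

text \<open>Herstein's identity \<open>[l, m] b = [l, m b] - m [l, b]\<close>.\<close>

lemma bracket_in_lie_core:
  assumes l: "l \<in> L" and m: "m \<in> L"
  shows "l * m - m * l \<in> lie_core L"
proof -
  have right: "(l * m - m * l) * b \<in> lie_normalizer L" for b
  proof -
    have "(l * m - m * l) * b = (l * (m * b) - m * b * l) - m * (l * b - b * l)"
      by (simp add: algebra_simps)
    then show ?thesis
      using l m by (simp add: lie_normalizer_diff_add lie_normalizer_mult L_subset_lie_normalizer swapped_bracket_L)
  qed
  moreover have none: "l * m - m * l \<in> lie_normalizer L"
    using l m by (simp add: L_subset_lie_normalizer swapped_bracket_L)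
  moreover have left: "a * x \<in> lie_normalizer L" if "x \<in> lie_normalizer L" "x * a \<in> lie_normalizer L" for a x
    using lie_normalizer_diff_add(2)[OF lie_normalizer_bracket[OF that(1), of a] that(2)] by simp
  ultimately have "a * (l * m - m * l) \<in> lie_normalizer L" "a * (l * m - m * l) * b \<in> lie_normalizer L" for a b
    using left[OF none right] left[OF right, of b a] right[of "b * a"] by (simp_all add: mult.assoc)
  with none right show ?thesis
    by (simp add: lie_core_def)
qed

end

text \<open>If \<open>d\<close> induces a derivation \<open>\<delta>\<close> with \<open>\<delta>\<^sup>2 = 0\<close> modulo \<open>K\<close>, then
  \<open>0 = \<delta>\<^sup>2(a b) = 2 \<delta>(a) \<delta>(b)\<close>, and \<open>0 = \<delta>(a) \<delta>(c b) = \<delta>(a) c \<delta>(b)\<close>; as the quotient by \<open>K\<close> is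
  semiprime, \<open>\<delta> = 0\<close> modulo \<open>K\<close>.\<close>

lemma bracket_in_ideal:
  fixes K :: "'a::cstar_algebra set"
  assumes K: "closed_ideal K" and semiprime: "\<And>x. (\<And>c. x * c * x \<in> K) \<Longrightarrow> x \<in> K"
    and nil: "\<And>a. d * (d * a - a * d) - (d * a - a * d) * d \<in> K"
  shows "d * a - a * d \<in> K"
proof -
  define \<delta> where "\<delta> = (\<lambda>a. d * a - a * d)"
  have prod: "\<delta> a * \<delta> b \<in> K" for a b
  proof -
    have "2 *\<^sub>R (\<delta> a * \<delta> b) = \<delta> (\<delta> (a * b)) - \<delta> (\<delta> a) * b - a * \<delta> (\<delta> b)"
      by (simp add: \<delta>_def algebra_simps scaleR_2)
    also have "\<dots> \<in> K"
      using nil by (intro closed_idealD[OF K]) (simp_all add: \<delta>_def)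
    finally have "(1/2) *\<^sub>R 2 *\<^sub>R (\<delta> a * \<delta> b) \<in> K"
      by (rule closed_idealD(6)[OF K])
    then show ?thesis by simp
  qed
  have "\<delta> a * c * \<delta> a \<in> K" for c
  proof -
    have "\<delta> a * c * \<delta> a = \<delta> a * \<delta> (c * a) - \<delta> a * \<delta> c * a"
      by (simp add: \<delta>_def algebra_simps)
    also have "\<dots> \<in> K"
      by (intro closed_idealD[OF K] prod)
    finally show ?thesis .
  qed
  then show ?thesis
    using semiprime[of "\<delta> a"] by (simp add: \<delta>_def)
qed

section \<open>Adjoining a unit\<close>

text \<open>A new unit is adjoined even if the algebra has one. Its purpose is to provide the
  exponential function and the elements \<open>1 + x\<close> uniformly in both cases; mapping \<open>1 + x\<close> to
  \<open>1 + x\<close> in the minimal unitization is compatible with multiplication. The norm is not the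
  C*-norm, but restricts to the given norm on the algebra.\<close>

datatype 'a unitized = Unitized (alg: 'a) (scal: complex)

lemma unitized_eq_iff: "u = v \<longleftrightarrow> alg u = alg v \<and> scal u = scal v"
  by (cases u; cases v) simp

instantiation unitized :: (cstar_algebra) real_normed_algebra_1
begin

definition "0 = Unitized 0 0"
definition "1 = Unitized 0 1"
definition "u + v = Unitized (alg u + alg v) (scal u + scal v)"
definition "u - v = Unitized (alg u - alg v) (scal u - scal v)"
definition "- u = Unitized (- alg u) (- scal u)"
definition "u * v = Unitized (alg u * alg v + scal u *\<^sub>C alg v + scal v *\<^sub>C alg u) (scal u * scal v)"
definition "r *\<^sub>R u = Unitized (r *\<^sub>R alg u) (r *\<^sub>R scal u)"
definition norm_unitized_def: "norm u = norm (alg u) + cmod (scal u)"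
definition sgn_unitized_def: "sgn (u :: 'a unitized) = inverse (norm u) *\<^sub>R u"
definition dist_unitized_def: "dist u v = norm (u - v :: 'a unitized)"
definition uniformity_unitized_def [code del]:
  "(uniformity :: ('a unitized \<times> 'a unitized) filter) = (INF e\<in>{0 <..}. principal {(x, y). dist x y < e})"
definition open_unitized_def [code del]:
  "open (S :: 'a unitized set) \<longleftrightarrow> (\<forall>x\<in>S. \<forall>\<^sub>F (x', y) in uniformity. x' = x \<longrightarrow> y \<in> S)"

lemma alg_scal [simp]:
  "alg 0 = 0" "scal 0 = 0" "alg 1 = 0" "scal 1 = 1"
  "alg (u + v) = alg u + alg v" "scal (u + v) = scal u + scal v"
  "alg (u - v) = alg u - alg v" "scal (u - v) = scal u - scal v"
  "alg (- u) = - alg u" "scal (- u) = - scal u"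
  "alg (u * v) = alg u * alg v + scal u *\<^sub>C alg v + scal v *\<^sub>C alg u" "scal (u * v) = scal u * scal v"
  "alg (r *\<^sub>R u) = r *\<^sub>R alg u" "scal (r *\<^sub>R u) = r *\<^sub>R scal u"
  by (simp_all add: zero_unitized_def one_unitized_def plus_unitized_def minus_unitized_def
      uminus_unitized_def times_unitized_def scaleR_unitized_def)

instance
proof
  have swap: "c *\<^sub>C r *\<^sub>R x = r *\<^sub>R c *\<^sub>C x" "(r *\<^sub>R c) *\<^sub>C x = r *\<^sub>R c *\<^sub>C x" for c r and x :: 'a
    by (simp_all flip: scaleC_of_real add: scaleC_scaleC mult.commute scaleR_conv_of_real)
  fix u v w :: "'a unitized" and r s :: real
  show "u + v + w = u + (v + w)" "u + v = v + u" "0 + u = u" "- u + u = 0" "u - v = u + - v"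
    "r *\<^sub>R (u + v) = r *\<^sub>R u + r *\<^sub>R v" "(r + s) *\<^sub>R u = r *\<^sub>R u + s *\<^sub>R u"
    "r *\<^sub>R s *\<^sub>R u = (r * s) *\<^sub>R u" "1 *\<^sub>R u = u" "(0::'a unitized) \<noteq> 1"
    by (simp_all add: unitized_eq_iff algebra_simps)
  show "u * v * w = u * (v * w)" "1 * u = u" "u * 1 = u"
    "(u + v) * w = u * w + v * w" "u * (v + w) = u * v + u * w"
    by (simp_all add: unitized_eq_iff algebra_simps mult_scaleC_left mult_scaleC_right
        scaleC.scale_right_distrib scaleC.scale_left_distrib)
  show "r *\<^sub>R u * v = r *\<^sub>R (u * v)" "u * r *\<^sub>R v = r *\<^sub>R (u * v)"
    by (simp_all add: unitized_eq_iff algebra_simps swap)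
  show "sgn u = inverse (norm u) *\<^sub>R u" "dist u v = norm (u - v)"
    "(uniformity :: ('a unitized \<times> 'a unitized) filter) = (INF e\<in>{0 <..}. principal {(x, y). dist x y < e})"
    "open S \<longleftrightarrow> (\<forall>x\<in>S. \<forall>\<^sub>F (x', y) in uniformity. x' = x \<longrightarrow> y \<in> S)" for S :: "'a unitized set"
    by (simp_all only: sgn_unitized_def dist_unitized_def uniformity_unitized_def open_unitized_def)
  show "norm u = 0 \<longleftrightarrow> u = 0"
    by (simp add: norm_unitized_def unitized_eq_iff add_nonneg_eq_0_iff)
  show "norm (u + v) \<le> norm u + norm v"
    using norm_triangle_ineq[of "alg u" "alg v"] norm_triangle_ineq[of "scal u" "scal v"]
    by (simp add: norm_unitized_def)
  show "norm (r *\<^sub>R u) = \<bar>r\<bar> * norm u" "norm (1 :: 'a unitized) = 1"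
    by (simp_all add: norm_unitized_def algebra_simps)
  have "norm (alg (u * v)) \<le> norm (alg u) * norm (alg v) + cmod (scal u) * norm (alg v) + cmod (scal v) * norm (alg u)"
    by (simp add: norm_mult_ineq norm_triangle_le add_mono norm_scaleC)
  then show "norm (u * v) \<le> norm u * norm v"
    by (simp add: norm_unitized_def norm_mult algebra_simps)
qed

end

lemma bounded_linear_alg: "bounded_linear (alg :: 'a::cstar_algebra unitized \<Rightarrow> 'a)"
  by (rule bounded_linear_intro[of _ 1]) (simp_all add: norm_unitized_def)

lemma bounded_linear_scal: "bounded_linear (scal :: 'a::cstar_algebra unitized \<Rightarrow> complex)"
  by (rule bounded_linear_intro[of _ 1]) (simp_all add: norm_unitized_def)

lemma bounded_linear_Unitized:
  assumes "bounded_linear f" "bounded_linear g"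
  shows "bounded_linear (\<lambda>x. Unitized (f x :: 'a::cstar_algebra) (g x))"
proof -
  interpret f: bounded_linear f by fact
  interpret g: bounded_linear g by fact
  from f.nonneg_bounded g.nonneg_bounded obtain K M
    where K: "\<And>x. norm (f x) \<le> norm x * K" and M: "\<And>x. norm (g x) \<le> norm x * M" by blast
  show ?thesis
    by (rule bounded_linear_intro[of _ "K + M"])
      (simp_all add: unitized_eq_iff f.add g.add f.scaleR g.scaleR norm_unitized_def distrib_left add_mono K M)
qed

instance unitized :: (cstar_algebra) banach
proof
  fix X :: "nat \<Rightarrow> 'a unitized" assume X: "Cauchy X"
  then have "Cauchy (\<lambda>n. alg (X n))" "Cauchy (\<lambda>n. scal (X n))"
    by (auto intro: bounded_linear.Cauchy bounded_linear_alg bounded_linear_scal)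
  then obtain a c where ac: "(\<lambda>n. alg (X n)) \<longlonglongrightarrow> a" "(\<lambda>n. scal (X n)) \<longlonglongrightarrow> c"
    by (auto simp: Cauchy_convergent_iff convergent_def)
  then have "(\<lambda>n. norm (alg (X n) - a) + norm (scal (X n) - c)) \<longlonglongrightarrow> norm (a - a) + norm (c - c)"
    by (intro tendsto_intros)
  then have "(\<lambda>n. norm (X n - Unitized a c)) \<longlonglongrightarrow> 0"
    by (simp add: norm_unitized_def)
  then have "X \<longlonglongrightarrow> Unitized a c"
    using LIM_zero_iff tendsto_norm_zero_iff by blast
  then show "convergent X"
    by (auto simp: convergent_def)
qed

definition embed :: "'a::cstar_algebra \<Rightarrow> 'a unitized" where
  "embed x = Unitized x 0"

lemma embed_simps [simp]: "alg (embed x) = x" "scal (embed x) = 0"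
  by (simp_all add: embed_def)

lemma bounded_linear_embed: "bounded_linear embed"
  unfolding embed_def by (intro bounded_linear_Unitized bounded_linear_ident bounded_linear_zero)

lemma norm_embed [simp]: "norm (embed x) = norm x"
  by (simp add: norm_unitized_def)

lemma embed_algebra:
  "embed (x + y) = embed x + embed y" "embed (x - y) = embed x - embed y" "embed (- x) = - embed x"
  "embed (r *\<^sub>R x) = r *\<^sub>R embed x" "embed 0 = 0" "embed (x * y) = embed x * embed y"
  by (simp_all add: unitized_eq_iff)

text \<open>Extending the involution to the unitization serves to see that the exponential of a
  skew-adjoint element is unitary.\<close>

definition ustar :: "'a::cstar_algebra unitized \<Rightarrow> 'a unitized" where
  "ustar u = Unitized (star (alg u)) (cnj (scal u))"

lemma bounded_linear_ustar: "bounded_linear (ustar :: 'a::cstar_algebra unitized \<Rightarrow> 'a unitized)"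
  unfolding ustar_def
  by (intro bounded_linear_Unitized bounded_linear_compose[OF bounded_linear_star bounded_linear_alg]
      bounded_linear_compose[OF bounded_linear_cnj bounded_linear_scal])

lemma ustar_mult: "ustar (u * v) = ustar v * ustar (u :: 'a::cstar_algebra unitized)"
  by (simp add: ustar_def unitized_eq_iff star_add star_mult star_scaleC add_ac)

lemma ustar_one [simp]: "ustar 1 = (1 :: 'a::cstar_algebra unitized)"
proof -
  have "star (0::'a) = 0"
    using linear_0[OF bounded_linear.linear[OF bounded_linear_star]] .
  then show ?thesis
    by (simp add: ustar_def unitized_eq_iff)
qed

lemma ustar_embed: "ustar (embed x) = embed (star (x :: 'a::cstar_algebra))"
  by (simp add: ustar_def unitized_eq_iff)

lemma ustar_exp: "ustar (exp u) = exp (ustar (u :: 'a::cstar_algebra unitized))"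
proof -
  have pow: "ustar (u ^ n) = ustar u ^ n" for n
    by (induction n) (simp_all add: ustar_mult power_commutes)
  have "(\<lambda>n. ustar (u ^ n /\<^sub>R fact n)) sums ustar (exp u)"
    by (rule bounded_linear.sums[OF bounded_linear_ustar exp_converges])
  then have "(\<lambda>n. ustar u ^ n /\<^sub>R fact n) sums ustar (exp u)"
    by (simp add: linear_scale[OF bounded_linear.linear[OF bounded_linear_ustar]] pow)
  then show ?thesis
    using exp_converges sums_unique2 by blast
qed

lemma embed_ideal:
  fixes I :: "'a::cstar_algebra set"
  assumes I: "closed_ideal I"
  shows "subspace (embed ` I)" "closed (embed ` I)"
    "x \<in> embed ` I \<Longrightarrow> u * x \<in> embed ` I" "x \<in> embed ` I \<Longrightarrow> x * u \<in> embed ` I"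
proof -
  have eq: "x \<in> embed ` I \<longleftrightarrow> scal x = 0 \<and> alg x \<in> I" for x
    by (auto simp: image_iff unitized_eq_iff)
  show "subspace (embed ` I)"
    by (rule linear_subspace_image[OF bounded_linear.linear[OF bounded_linear_embed] subspace_closed_ideal[OF I]])
  have "embed ` I = scal -` {0} \<inter> alg -` I"
    by (auto simp: eq)
  moreover have "closed (scal -` {0} :: 'a unitized set)" "closed (alg -` I)"
    by (rule closed_vimage[OF closed_singleton linear_continuous_on[OF bounded_linear_scal]]
        closed_vimage[OF closed_idealD(9)[OF I] linear_continuous_on[OF bounded_linear_alg]])+
  ultimately show "closed (embed ` I)"
    by (simp only: closed_Int)
  show "x \<in> embed ` I \<Longrightarrow> u * x \<in> embed ` I" "x \<in> embed ` I \<Longrightarrow> x * u \<in> embed ` I"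
    by (auto simp: eq closed_idealD(2,5,7,8)[OF I])
qed

lemma exp_embed:
  fixes I :: "'a::cstar_algebra set"
  assumes "closed_ideal I" "x \<in> I"
  obtains s where "s \<in> I" "exp (embed x) = 1 + embed s"
proof -
  have "exp (embed x) - 1 \<in> embed ` I"
    using assms embed_ideal[OF assms(1)] by (intro exp_minus_one_in_ideal) auto
  then obtain s where "s \<in> I" "exp (embed x) - 1 = embed s"
    by auto
  then show thesis
    by (intro that[of s]) (auto simp: algebra_simps)
qed

section \<open>Approximate units\<close>

text \<open>The element \<open>1 - u\<close> of the unitization acts by contractions.\<close>

definition contracts :: "'a::cstar_algebra \<Rightarrow> bool" where
  "contracts u \<longleftrightarrow> (\<forall>z. norm (z - z * u) \<le> norm z \<and> norm (z - u * z) \<le> norm z)"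

text \<open>The exponential \<open>w = 1 + s\<close> satisfies \<open>w w\<^sup>* = w\<^sup>* w = 1\<close>, so \<open>(z w) (z w)\<^sup>* = z z\<^sup>*\<close> and the
  C*-identity shows that multiplication by \<open>w\<close> is isometric. The bound on \<open>s\<close> comes from
  \<open>s\<^sup>* s = s\<^sup>* w - s\<^sup>*\<close>.\<close>

lemma exp_skew_adjoint_unitary:
  fixes d :: "'a::cstar_algebra"
  assumes d: "star d = - d" and s: "exp (embed d) = 1 + embed s"
  shows "norm (z + z * s) = norm z" "norm (z + s * z) = norm z" "norm s \<le> 2"
proof -
  define E where "E = exp (embed d)"
  have uE: "ustar E = exp (- embed d)"
    by (simp add: E_def ustar_exp ustar_embed d embed_algebra)
  have inv: "E * ustar E = 1" "ustar E * E = 1"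
    unfolding uE unfolding E_def by (rule exp_minus_inverse exp_minus_inverse')+
  have right: "norm (z + z * s) = norm z" for z
  proof -
    have e: "embed (z + z * s) = embed z * E"
      by (simp add: E_def s embed_algebra algebra_simps)
    have "embed ((z + z * s) * star (z + z * s)) = embed z * E * ustar (embed z * E)"
      by (simp only: embed_algebra(6) e flip: ustar_embed)
    also have "\<dots> = embed z * (E * ustar E) * ustar (embed z)"
      by (simp only: ustar_mult mult.assoc)
    also have "\<dots> = embed (z * star z)"
      by (simp add: inv ustar_embed embed_algebra)
    finally have "(norm (z + z * s))\<^sup>2 = (norm z)\<^sup>2"
      by (metis norm_embed norm_mult_star)
    then show ?thesis by simp
  qed
  show "norm (z + z * s) = norm z" by (rule right)
  show "norm (z + s * z) = norm z"
  proof -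
    have e: "embed (z + s * z) = E * embed z"
      by (simp add: E_def s embed_algebra algebra_simps)
    have "embed (star (z + s * z) * (z + s * z)) = ustar (E * embed z) * (E * embed z)"
      by (simp only: embed_algebra(6) e flip: ustar_embed)
    also have "\<dots> = ustar (embed z) * (ustar E * E) * embed z"
      by (simp only: ustar_mult mult.assoc)
    also have "\<dots> = embed (star z * z)"
      by (simp add: inv ustar_embed embed_algebra)
    finally have "(norm (z + s * z))\<^sup>2 = (norm z)\<^sup>2"
      by (metis norm_embed norm_star_mult)
    then show ?thesis by simp
  qed
  have "norm (star s * s) \<le> norm (star s + star s * s) + norm (star s)"
    using norm_triangle_ineq4[of "star s + star s * s" "star s"] by simp
  then have "norm s * norm s \<le> 2 * norm s"
    by (simp add: norm_star_mult right power2_eq_square)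
  then show "norm s \<le> 2"
    by (cases "s = 0") auto
qed

text \<open>With \<open>w = exp (i b / m)\<close> unitary, the average \<open>1 - u\<close> of \<open>1, w, \<dots>, w\<^sup>n\<^sup>-\<^sup>1\<close> is a contraction,
  and \<open>(w - 1) (1 - u) = (w\<^sup>n - 1) / n\<close> is small; \<open>m (w - 1)\<close> approximates \<open>i b\<close>.\<close>

lemma self_adjoint_unit:
  fixes I :: "'a::cstar_algebra set"
  assumes I: "closed_ideal I" and b: "b \<in> I" "star b = b" and "0 < \<delta>"
  obtains u where "u \<in> I" "contracts u" "norm (b - b * u) < \<delta>"
proof -
  define d where "d = \<i> *\<^sub>C b"
  have d: "d \<in> I" "star d = - d"
    using b closed_idealD(5)[OF I] by (simp_all add: d_def star_scaleC)
  have "(\<lambda>m. real (Suc m) *\<^sub>R (exp (embed d /\<^sub>R real (Suc m)) - 1)) \<longlonglongrightarrow> embed d"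
    by (rule exp_difference_quotient)
  from LIMSEQ_D[OF this, of "\<delta> / 2"] \<open>0 < \<delta>\<close> obtain m
    where m: "norm (real (Suc m) *\<^sub>R (exp (embed d /\<^sub>R real (Suc m)) - 1) - embed d) < \<delta> / 2"
    by (metis half_gt_zero order_refl)
  define w where "w = exp (embed d /\<^sub>R real (Suc m))"
  have "\<exists>s. s \<in> I \<and> w ^ k = 1 + embed s \<and> norm s \<le> 2 \<and>
      (\<forall>z. norm (z + z * s) = norm z \<and> norm (z + s * z) = norm z)" for k
  proof -
    define d' where "d' = (real k / real (Suc m)) *\<^sub>R d"
    have d': "d' \<in> I" "star d' = - d'"
      using d closed_idealD(6)[OF I] by (simp_all add: d'_def star_scaleR)
    have wk: "w ^ k = exp (embed d')"
      by (simp add: w_def d'_def exp_power embed_algebra divide_inverse del: of_nat_Suc)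
    from exp_embed[OF I d'(1)] obtain s where s: "s \<in> I" "exp (embed d') = 1 + embed s" .
    show ?thesis
      using s exp_skew_adjoint_unitary[OF d'(2) s(2)] by (auto simp: wk)
  qed
  then obtain s where s: "\<And>k. s k \<in> I" "\<And>k. w ^ k = 1 + embed (s k)" "\<And>k. norm (s k) \<le> 2"
      "\<And>k z. norm (z + z * s k) = norm z" "\<And>k z. norm (z + s k * z) = norm z"
    by metis
  obtain n where n: "4 * real (Suc m) / \<delta> < real n"
    using reals_Archimedean2 by blast
  then have "0 < real n"
    using \<open>0 < \<delta>\<close> by (intro le_less_trans[OF _ n]) simp
  then have "n > 0" by simp
  define u where "u = - ((\<Sum>k<n. s k) /\<^sub>R real n)"
  have u: "u \<in> I"
    unfolding u_def using s(1) by (intro closed_idealD[OF I] subspace_sum[OF subspace_closed_ideal[OF I]])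
  have average: "norm ((\<Sum>k<n. f k) /\<^sub>R real n) \<le> c" if "\<And>k. norm (f k) \<le> c" for f :: "nat \<Rightarrow> 'a" and c
  proof -
    have "norm (\<Sum>k<n. f k) \<le> real n * c"
      using sum_norm_le[of "{..<n}" f "\<lambda>_. c"] that by simp
    then show ?thesis
      using \<open>n > 0\<close> by (simp add: field_simps)
  qed
  have contracts: "contracts u"
    unfolding contracts_def
  proof (intro allI conjI)
    fix z
    have "z - z * u = (\<Sum>k<n. z + z * s k) /\<^sub>R real n"
      using \<open>n > 0\<close> by (simp add: u_def sum.distrib scaleR_add_right sum_distrib_left sum_constant_scaleR)
    then show "norm (z - z * u) \<le> norm z"
      using average[of "\<lambda>k. z + z * s k" "norm z"] by (simp only: s order_refl)
    have "z - u * z = (\<Sum>k<n. z + s k * z) /\<^sub>R real n"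
      using \<open>n > 0\<close> by (simp add: u_def sum.distrib scaleR_add_right sum_distrib_right sum_constant_scaleR)
    then show "norm (z - u * z) \<le> norm z"
      using average[of "\<lambda>k. z + s k * z" "norm z"] by (simp only: s order_refl)
  qed
  \<comment> \<open>the approximation \<open>m (w - 1)\<close> of \<open>i b\<close>, seen as an element of the algebra\<close>
  define e where "e = real (Suc m) *\<^sub>R s 1"
  have e: "embed e = real (Suc m) *\<^sub>R (w - 1)"
    using s(2)[of 1] by (simp add: e_def embed_algebra del: of_nat_Suc)
  have "norm (embed (e - d)) < \<delta> / 2"
    using m by (simp add: embed_algebra e w_def del: of_nat_Suc norm_embed)
  then have ed: "norm (d - e) < \<delta> / 2"
    by (simp add: norm_minus_commute)
  have "embed (e - e * u) = embed e * (1 - embed u)"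
    by (simp add: embed_algebra algebra_simps)
  also have "1 - embed u = (\<Sum>k<n. w ^ k) /\<^sub>R real n"
  proof -
    have "embed (\<Sum>k<n. s k) = (\<Sum>k<n. embed (s k))"
      by (rule linear_sum[OF bounded_linear.linear[OF bounded_linear_embed]])
    then show ?thesis
      using \<open>n > 0\<close> by (simp add: u_def embed_algebra s(2) sum.distrib scaleR_add_right sum_constant_scaleR del: sum_constant)
  qed
  also have "embed e * \<dots> = (real (Suc m) / real n) *\<^sub>R ((w - 1) * (\<Sum>k<n. w ^ k))"
    by (simp add: e divide_inverse mult.commute del: of_nat_Suc)
  also have "(w - 1) * (\<Sum>k<n. w ^ k) = embed (s n)"
  proof -
    have "(w - 1) * (\<Sum>k<n. w ^ k) = w ^ n - 1"
      by (induction n) (simp_all add: algebra_simps)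
    then show ?thesis
      by (simp add: s(2))
  qed
  also have "(real (Suc m) / real n) *\<^sub>R embed (s n) = embed ((real (Suc m) / real n) *\<^sub>R s n)"
    by (simp only: embed_algebra)
  finally have "norm (e - e * u) = norm ((real (Suc m) / real n) *\<^sub>R s n)"
    by (metis norm_embed)
  also have "\<dots> \<le> (real (Suc m) / real n) * 2"
    unfolding norm_scaleR using s(3)[of n] by (intro mult_mono) auto
  also have "\<dots> < \<delta> / 2"
    using n \<open>0 < real n\<close> \<open>0 < \<delta>\<close> by (simp add: field_simps)
  finally have eu: "norm (e - e * u) < \<delta> / 2" .
  have "d - d * u = (e - e * u) + ((d - e) - (d - e) * u)"
    by (simp add: algebra_simps)
  then have "norm (d - d * u) \<le> norm (e - e * u) + norm ((d - e) - (d - e) * u)"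
    by (metis norm_triangle_ineq)
  also have "\<dots> < \<delta>"
    using eu ed contracts[unfolded contracts_def, rule_format, of "d - e"] by simp
  also have "d - d * u = \<i> *\<^sub>C (b - b * u)"
    by (simp add: d_def mult_scaleC_left scaleC.scale_right_diff_distrib)
  finally show thesis
    using u contracts by (intro that) (simp_all add: norm_scaleC)
qed

text \<open>With \<open>b = z\<^sup>* z\<close> and \<open>v = 1 - u\<close> one has \<open>(z v)\<^sup>* (z v) = v\<^sup>* (b v)\<close>, so a unit for the self-adjoint
  element \<open>b\<close> is a right unit for \<open>z\<close>.\<close>

lemma right_unit:
  fixes I :: "'a::cstar_algebra set"
  assumes I: "closed_ideal I" and z: "star z * z \<in> I" and "0 < \<delta>"
  obtains u where "u \<in> I" "contracts u" "norm (z - z * u) < \<delta>"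
proof -
  define b where "b = star z * z"
  have b: "b \<in> I" "star b = b"
    using z by (simp_all add: b_def star_mult star_star)
  from self_adjoint_unit[OF I b, of "\<delta>\<^sup>2"] \<open>0 < \<delta>\<close> obtain u
    where u: "u \<in> I" "contracts u" "norm (b - b * u) < \<delta>\<^sup>2" by auto
  define y where "y = b - b * u"
  have "(norm (z - z * u))\<^sup>2 = norm (star (z - z * u) * (z - z * u))"
    by (simp add: norm_star_mult)
  also have "star (z - z * u) * (z - z * u) = y - star u * y"
    by (simp add: y_def b_def star_diff star_mult algebra_simps)
  also have "norm (y - star u * y) = norm (star y - star y * u)"
    using norm_star[of "y - star u * y"] by (simp add: star_diff star_mult star_star)
  also have "\<dots> \<le> norm y"
    using u(2) norm_star[of y] by (metis contracts_def)
  also have "\<dots> < \<delta>\<^sup>2"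
    using u by (simp add: y_def)
  finally have "norm (z - z * u) < \<delta>"
    using \<open>0 < \<delta>\<close> power_less_imp_less_base[of "norm (z - z * u)" 2 \<delta>] by simp
  with u show thesis
    by (intro that)
qed

text \<open>Being a limit of elements \<open>z u\<close>, the element \<open>z\<close> lies in the ideal as soon as \<open>z\<^sup>* z\<close> does. This
  yields that closed ideals are self-adjoint and semiprime.\<close>

lemma mem_of_star_mult:
  fixes I :: "'a::cstar_algebra set"
  assumes I: "closed_ideal I" and z: "star z * z \<in> I"
  shows "z \<in> I"
proof -
  have "\<exists>y\<in>I. dist y z < \<delta>" if \<delta>: "0 < \<delta>" for \<delta>
  proof -
    from right_unit[OF I z \<delta>] obtain u where "u \<in> I" "norm (z - z * u) < \<delta>" .
    then show ?thesis
      by (intro bexI[of _ "z * u"] closed_idealD(7)[OF I]) (simp_all add: dist_norm norm_minus_commute)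
  qed
  then show ?thesis
    using closed_approachable[OF closed_idealD(9)[OF I]] by blast
qed

lemma star_closed_ideal:
  fixes I :: "'a::cstar_algebra set"
  assumes I: "closed_ideal I" and "x \<in> I"
  shows "star x \<in> I"
  by (rule mem_of_star_mult[OF I]) (simp add: star_star closed_idealD(8)[OF I assms(2)])

lemma semiprime_closed_ideal:
  fixes I :: "'a::cstar_algebra set"
  assumes I: "closed_ideal I" and x: "\<And>c. x * c * x \<in> I"
  shows "x \<in> I"
proof -
  have "star (star x * x) * (star x * x) = star x * (x * star x * x)"
    by (simp add: star_mult star_star mult.assoc)
  then have "star (star x * x) * (star x * x) \<in> I"
    using closed_idealD(7)[OF I x] by simp
  then show ?thesis
    by (intro mem_of_star_mult[OF I, of x] mem_of_star_mult[OF I, of "star x * x"])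
qed

text \<open>Units for single elements are combined by multiplying: \<open>1 - w = (1 - u) (1 - v)\<close>. The factor
  \<open>1 - v\<close> is a contraction, so it preserves what \<open>1 - u\<close> has achieved.\<close>

lemma approximate_unit:
  fixes I :: "'a::cstar_algebra set"
  assumes I: "closed_ideal I" and F: "finite F" "F \<subseteq> I" and \<delta>: "0 < \<delta>"
  shows "\<exists>u\<in>I. contracts u \<and> (\<forall>x\<in>F. norm (x - x * u) < \<delta>)"
  using F
proof (induction F rule: finite_induct)
  case empty
  have "0 \<in> I"
    by (rule closed_idealD[OF I])
  then show ?case
    by (intro bexI[of _ 0]) (simp_all add: contracts_def)
next
  case (insert x F)
  then obtain u where u: "u \<in> I" "contracts u" "\<And>x. x \<in> F \<Longrightarrow> norm (x - x * u) < \<delta>"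
    by auto
  have "x - x * u \<in> I"
    using insert.prems by (intro closed_idealD(3,8)[OF I]) auto
  then have "star (x - x * u) * (x - x * u) \<in> I"
    by (rule closed_idealD(7)[OF I])
  from right_unit[OF I this \<delta>] obtain v
    where v: "v \<in> I" "contracts v" "norm ((x - x * u) - (x - x * u) * v) < \<delta>" .
  define w where "w = u + v - u * v"
  have right: "y - y * w = (y - y * u) - (y - y * u) * v" and left: "y - w * y = (y - v * y) - u * (y - v * y)" for y
    by (simp_all add: w_def algebra_simps)
  have "w \<in> I"
    unfolding w_def using u(1) v(1) by (intro closed_idealD[OF I])
  moreover have "contracts w"
    unfolding contracts_def right left
    using u(2) v(2) unfolding contracts_def by (meson order_trans)
  moreover have "norm (y - y * w) < \<delta>" if "y \<in> insert x F" for y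
  proof (cases "y = x")
    case True
    then show ?thesis using v(3) by (simp only: right)
  next
    case False
    then show ?thesis
      using that u(3)[of y] v(2) unfolding right contracts_def by (auto intro: le_less_trans)
  qed
  ultimately show ?case by blast
qed

text \<open>Choose \<open>u\<^sub>1, u\<^sub>2, \<dots>\<close> successively. Let \<open>D\<close> be the sum of the brackets \<open>[u\<^sub>j, a]\<close> already obtained, and
  let the next \<open>u\<close> be a right unit for \<open>D\<^sup>*\<close> and \<open>D\<^sup>* a\<close>. Then \<open>D\<^sup>* [u, a] = D\<^sup>* u a - D\<^sup>* a u\<close> is nearly zero, and by
  the C*-identity the squares of the norms of the brackets add up: the sum of \<open>n\<close> of them has
  norm of order \<open>\<surd>n\<close> rather than \<open>n\<close>. So the average of the \<open>u\<^sub>j\<close> almost commutes with \<open>a\<close>.\<close>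

lemma quasicentral_unit:
  fixes I :: "'a::cstar_algebra set"
  assumes I: "closed_ideal I" and x: "x \<in> I" and \<epsilon>: "0 < \<epsilon>"
  obtains u where "u \<in> I" "norm (x - x * u) < \<epsilon>" "norm (u * a - a * u) < \<epsilon>"
proof -
  define C where "C = (2 * norm a)\<^sup>2 + 1"
  have "0 < C"
    by (simp add: C_def add_nonneg_pos)
  have sums: "\<exists>s\<in>I. norm (real n *\<^sub>R x - x * s) \<le> real n * (\<epsilon> / 2) \<and>
      (norm (s * a - a * s))\<^sup>2 \<le> real n * C" for n
  proof (induction n)
    case 0
    show ?case
      by (intro bexI[of _ 0]) (simp_all add: closed_idealD[OF I])
  next
    case (Suc n)
    then obtain s where s: "s \<in> I" "norm (real n *\<^sub>R x - x * s) \<le> real n * (\<epsilon> / 2)"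
      "(norm (s * a - a * s))\<^sup>2 \<le> real n * C" by auto
    define D where "D = s * a - a * s"
    have D: "D \<in> I" "star D \<in> I"
      using s(1) by (simp_all add: D_def closed_idealD[OF I] star_closed_ideal[OF I])
    define \<delta> where "\<delta> = min (\<epsilon> / 2) (1 / (2 * (norm a + 1)))"
    have "0 < norm a + 1"
      by (simp add: add_nonneg_pos)
    then have \<delta>: "0 < \<delta>" "\<delta> \<le> \<epsilon> / 2" "\<delta> \<le> 1 / (2 * (norm a + 1))"
      using \<epsilon> by (simp_all add: \<delta>_def)
    have "{x, star D, star D * a} \<subseteq> I"
      using x D by (simp add: closed_idealD[OF I])
    from approximate_unit[OF I _ this \<delta>(1)] obtain u
      where u: "u \<in> I" "contracts u" "norm (x - x * u) < \<delta>" "norm (star D - star D * u) < \<delta>"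
        "norm (star D * a - star D * a * u) < \<delta>"
      by auto
    define d where "d = u * a - a * u"
    have "d = (a - a * u) - (a - u * a)"
      by (simp add: d_def)
    then have "norm d \<le> norm (a - a * u) + norm (a - u * a)"
      by (metis norm_triangle_ineq4)
    also have "\<dots> \<le> 2 * norm a"
      using u(2) unfolding contracts_def by (smt (verit, best))
    finally have nd: "(norm d)\<^sup>2 \<le> (2 * norm a)\<^sup>2"
      by (intro power_mono) auto
    have "star D * d = (star D * a - star D * a * u) - (star D - star D * u) * a"
      by (simp add: d_def algebra_simps)
    then have "norm (star D * d) \<le> \<delta> + \<delta> * norm a"
      using u(4,5) norm_triangle_ineq4[of "star D * a - star D * a * u" "(star D - star D * u) * a"]
        norm_mult_ineq[of "star D - star D * u" a] mult_right_mono[of "norm (star D - star D * u)" \<delta> "norm a"]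
      by simp
    also have "\<dots> = \<delta> * (norm a + 1)"
      by (simp add: algebra_simps)
    also have "\<dots> \<le> 1 / (2 * (norm a + 1)) * (norm a + 1)"
      using \<delta>(3) \<open>0 < norm a + 1\<close> by (intro mult_right_mono) auto
    also have "\<dots> = 1 / 2"
      using \<open>0 < norm a + 1\<close> by simp
    finally have Dd: "norm (star D * d) \<le> 1 / 2" .
    have dD: "norm (star d * D) = norm (star D * d)"
      using norm_star[of "star D * d"] by (simp add: star_mult star_star)
    have "(norm (D + d))\<^sup>2 = norm (star D * D + star d * d + star D * d + star d * D)"
      unfolding norm_star_mult[symmetric] by (simp add: star_add algebra_simps)
    also have "\<dots> \<le> norm (star D * D) + norm (star d * d) + norm (star D * d) + norm (star d * D)"
      by (intro order_trans[OF norm_triangle_ineq] add_mono order_refl)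
    also have "\<dots> \<le> real n * C + ((2 * norm a)\<^sup>2 + 1)"
      using Dd s(3)[folded D_def] nd by (simp add: dD norm_star_mult)
    finally have "(norm (D + d))\<^sup>2 \<le> real (Suc n) * C"
      by (simp add: C_def algebra_simps)
    moreover have "D + d = (s + u) * a - a * (s + u)"
      by (simp add: D_def d_def algebra_simps)
    moreover have "norm (real (Suc n) *\<^sub>R x - x * (s + u)) \<le> real (Suc n) * (\<epsilon> / 2)"
    proof -
      have "real (Suc n) *\<^sub>R x - x * (s + u) = (real n *\<^sub>R x - x * s) + (x - x * u)"
        by (simp add: algebra_simps)
      then have "norm (real (Suc n) *\<^sub>R x - x * (s + u)) \<le> real n * (\<epsilon> / 2) + \<epsilon> / 2"
        using norm_triangle_ineq[of "real n *\<^sub>R x - x * s" "x - x * u"] s(2) u(3) \<delta>(2) by simp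
      then show ?thesis
        by (simp add: algebra_simps)
    qed
    moreover have "s + u \<in> I"
      using s u by (simp add: closed_idealD[OF I])
    ultimately show ?case
      by metis
  qed
  obtain n where n: "C / \<epsilon>\<^sup>2 < real n"
    using reals_Archimedean2 by blast
  have "0 < C / \<epsilon>\<^sup>2"
    using \<open>0 < C\<close> \<epsilon> by simp
  then have "0 < real n"
    using n by linarith
  from sums[of n] obtain s where s: "s \<in> I" "norm (real n *\<^sub>R x - x * s) \<le> real n * (\<epsilon> / 2)"
      "(norm (s * a - a * s))\<^sup>2 \<le> real n * C" by auto
  define u where "u = s /\<^sub>R real n"
  have "x - x * u = (real n *\<^sub>R x - x * s) /\<^sub>R real n"
    using \<open>0 < real n\<close> by (simp add: u_def scaleR_diff_right)
  then have "norm (x - x * u) = norm (real n *\<^sub>R x - x * s) / real n"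
    by (simp add: divide_inverse mult.commute)
  also have "\<dots> \<le> \<epsilon> / 2"
    using s(2) \<open>0 < real n\<close> by (simp add: pos_divide_le_eq mult.commute)
  also have "\<dots> < \<epsilon>"
    using \<epsilon> by simp
  finally have xu: "norm (x - x * u) < \<epsilon>" .
  have "u * a - a * u = (s * a - a * s) /\<^sub>R real n"
    by (simp add: u_def scaleR_diff_right)
  then have "norm (u * a - a * u) = norm (s * a - a * s) / real n"
    by (simp add: divide_inverse mult.commute)
  then have "(norm (u * a - a * u))\<^sup>2 = (norm (s * a - a * s))\<^sup>2 / (real n)\<^sup>2"
    by (simp only: power_divide)
  also have "\<dots> \<le> real n * C / (real n)\<^sup>2"
    using s(3) by (intro divide_right_mono) auto
  also have "\<dots> = C / real n"
    using \<open>0 < real n\<close> by (simp add: power2_eq_square)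
  also have "\<dots> < \<epsilon>\<^sup>2"
    using n \<epsilon> \<open>0 < real n\<close> by (simp add: field_simps)
  finally have "norm (u * a - a * u) < \<epsilon>"
    using \<epsilon> power_less_imp_less_base[of "norm (u * a - a * u)" 2 \<epsilon>] by simp
  with xu s(1) show thesis
    by (intro that[of u]) (simp_all add: u_def closed_idealD[OF I])
qed

text \<open>Here \<open>[z, a]\<close> is close to \<open>[z, a] u\<close>, hence to \<open>[z u, a]\<close>.\<close>

lemma bracket_in_closure:
  fixes I :: "'a::cstar_algebra set"
  assumes I: "closed_ideal I" and L: "closed L" "\<And>y. y \<in> I \<Longrightarrow> y * a - a * y \<in> L"
    and z: "z * a - a * z \<in> I"
  shows "z * a - a * z \<in> L"
proof -
  have "\<exists>y\<in>L. dist y (z * a - a * z) < \<epsilon>" if \<epsilon>: "0 < \<epsilon>" for \<epsilon>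
  proof -
    define \<delta> where "\<delta> = \<epsilon> / (norm z + 2)"
    have "0 < norm z + 2"
      using norm_ge_zero[of z] by linarith
    then have "0 < \<delta>"
      using \<epsilon> by (simp add: \<delta>_def)
    from quasicentral_unit[OF I z this] obtain u where u: "u \<in> I"
      "norm ((z * a - a * z) - (z * a - a * z) * u) < \<delta>" "norm (u * a - a * u) < \<delta>" .
    have split: "z * u * a - a * (z * u) - (z * a - a * z) =
        z * (u * a - a * u) - ((z * a - a * z) - (z * a - a * z) * u)"
      by (simp add: algebra_simps)
    have "norm (z * u * a - a * (z * u) - (z * a - a * z)) \<le> norm z * \<delta> + \<delta>"
      unfolding split
      using u norm_triangle_ineq4[of "z * (u * a - a * u)" "(z * a - a * z) - (z * a - a * z) * u"]
        norm_mult_ineq[of z "u * a - a * u"] mult_left_mono[of "norm (u * a - a * u)" \<delta> "norm z"]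
      by simp
    also have "\<dots> < \<delta> * (norm z + 2)"
      using \<open>0 < \<delta>\<close> by (simp add: algebra_simps)
    also have "\<dots> = \<epsilon>"
      using \<open>0 < norm z + 2\<close> by (simp add: \<delta>_def)
    finally show ?thesis
      using u(1) by (intro bexI[of _ "z * u * a - a * (z * u)"] L closed_idealD(7)[OF I]) (simp_all add: dist_norm)
  qed
  then show ?thesis
    using closed_approachable[OF L(1)] by blast
qed

section \<open>The identity component\<close>

definition invertibles :: "'a::cstar_algebra set \<Rightarrow> 'a unitized set" where
  "invertibles I = {g. g - 1 \<in> embed ` I \<and> (\<exists>k. g * k = 1 \<and> k * g = 1)}"

definition id_component :: "'a::cstar_algebra set \<Rightarrow> 'a unitized set" where
  "id_component I = connected_component_set (invertibles I) 1"

context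
  fixes I :: "'a::cstar_algebra set"
  assumes I: "closed_ideal I"
begin

lemma one_invertibles: "1 \<in> invertibles I"
  using closed_idealD(1)[OF I] by (auto simp: invertibles_def image_iff embed_algebra intro!: bexI[of _ 0])

lemma one_id_component: "1 \<in> id_component I"
  by (simp add: id_component_def one_invertibles)

lemma id_component_subset: "id_component I \<subseteq> invertibles I"
  unfolding id_component_def by (rule connected_component_subset)

lemma mult_invertibles:
  assumes "g \<in> invertibles I" "h \<in> invertibles I"
  shows "g * h \<in> invertibles I"
proof -
  from assms obtain g' h' where "g * g' = 1" "g' * g = 1" "h * h' = 1" "h' * h = 1"
    by (auto simp: invertibles_def)
  then have "g * h * (h' * g') = 1" "h' * g' * (g * h) = 1"
    by (metis mult.assoc mult_1_left)+
  moreover have "g * (h - 1) + (g - 1) \<in> embed ` I"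
    using assms by (intro subspace_add embed_ideal[OF I]) (simp_all add: invertibles_def)
  then have "g * h - 1 \<in> embed ` I"
    by (simp add: algebra_simps)
  ultimately show ?thesis
    by (auto simp: invertibles_def)
qed

lemma exp_invertibles:
  assumes "y \<in> I"
  shows "exp (embed y) \<in> invertibles I"
proof -
  from exp_embed[OF I assms] obtain s where "s \<in> I" "exp (embed y) = 1 + embed s" .
  then have "exp (embed y) - 1 \<in> embed ` I"
    by simp
  moreover have "exp (embed y) * exp (- embed y) = 1" "exp (- embed y) * exp (embed y) = 1"
    by (rule exp_minus_inverse exp_minus_inverse')+
  ultimately show ?thesis
    unfolding invertibles_def by blast
qed

lemma mult_exp_id_component:
  assumes g: "g \<in> id_component I" and y: "y \<in> I"
  shows "g * exp (embed y) \<in> id_component I"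
proof -
  define P where "P = (\<lambda>t. g * exp (t *\<^sub>R embed y)) ` {0..1}"
  have "connected P"
    unfolding P_def
  proof (intro connected_continuous_image)
    show "continuous_on {0..1} (\<lambda>t. g * exp (t *\<^sub>R embed y))"
      unfolding continuous_on_def by (intro ballI tendsto_mult tendsto_exp_algebra tendsto_intros)
  qed simp
  moreover have "P \<subseteq> invertibles I"
  proof -
    have "exp (t *\<^sub>R embed y) \<in> invertibles I" for t
      using exp_invertibles[of "t *\<^sub>R y"] y closed_idealD(6)[OF I] by (simp add: embed_algebra)
    then show ?thesis
      using g id_component_subset by (auto simp: P_def intro!: mult_invertibles)
  qed
  moreover have "g \<in> P"
    unfolding P_def by (rule image_eqI[of _ _ 0]) auto
  ultimately have "P \<subseteq> connected_component_set (invertibles I) g"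
    by (intro connected_component_maximal)
  also have "\<dots> = id_component I"
    using g unfolding id_component_def by (metis connected_component_eq)
  finally show ?thesis
    unfolding P_def image_subset_iff by (elim ballE[of _ _ 1]) simp_all
qed

text \<open>The exponentials generate the identity component: every invertible near \<open>a\<close> is \<open>a exp y\<close>, so
  a property that is stable under multiplication by exponentials is locally constant.\<close>

lemma id_component_induct [consumes 1, case_names one mult_exp]:
  assumes g: "g \<in> id_component I" and one: "P 1"
    and mult_exp: "\<And>g y. g \<in> id_component I \<Longrightarrow> P g \<Longrightarrow> y \<in> I \<Longrightarrow> P (g * exp (embed y))"
  shows "P g"
proof (rule connected_induction_simple[where P = P])
  show "connected (id_component I)"
    by (simp add: id_component_def)
  show "1 \<in> id_component I" "g \<in> id_component I" "P 1"
    by (fact one_id_component g one)+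
  fix a assume a: "a \<in> id_component I"
  then obtain k where k: "a * k = 1" "k * a = 1" and a1: "a - 1 \<in> embed ` I"
    using id_component_subset by (auto simp: invertibles_def)
  obtain \<delta> where \<delta>: "0 < \<delta>" "\<And>z. z \<in> embed ` I \<Longrightarrow> norm z < \<delta> \<Longrightarrow> \<exists>y\<in>embed ` I. exp y = 1 + z"
    using local_logarithm[OF embed_ideal(1-3)[OF I]] by blast
  define \<epsilon> where "\<epsilon> = \<delta> / (norm k + 1)"
  have "0 < norm k + 1"
    by (simp add: add_nonneg_pos)
  then have \<epsilon>: "0 < \<epsilon>"
    using \<delta> by (simp add: \<epsilon>_def)
  define T where "T = id_component I \<inter> ball a \<epsilon>"
  have log: "\<exists>y\<in>I. x = a * exp (embed y)" if x: "x \<in> T" for x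
  proof -
    have "x - 1 \<in> embed ` I"
      using x id_component_subset by (auto simp: T_def invertibles_def)
    then have "k * ((x - 1) - (a - 1)) \<in> embed ` I"
      by (rule embed_ideal(3)[OF I subspace_diff[OF embed_ideal(1)[OF I] _ a1]])
    then have "k * (x - a) \<in> embed ` I"
      by simp
    moreover have "norm (k * (x - a)) < \<delta>"
    proof -
      have "norm (k * (x - a)) \<le> norm k * norm (x - a)"
        by (rule norm_mult_ineq)
      also have "\<dots> \<le> norm k * \<epsilon>"
        using x by (intro mult_left_mono) (auto simp: T_def dist_norm norm_minus_commute)
      also have "\<dots> < \<delta>"
        using \<delta>(1) \<open>0 < norm k + 1\<close> by (simp add: \<epsilon>_def pos_divide_less_eq algebra_simps)
      finally show ?thesis .
    qed
    ultimately obtain y where y: "y \<in> I" "exp (embed y) = 1 + k * (x - a)"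
      using \<delta>(2) by blast
    have "a * exp (embed y) = a + (a * k) * (x - a)"
      by (simp add: y(2) distrib_left mult.assoc)
    then show ?thesis
      using y(1) k(1) by (intro bexI[of _ y]) simp_all
  qed
  show "\<exists>T. openin (top_of_set (id_component I)) T \<and> a \<in> T \<and> (\<forall>x\<in>T. \<forall>y\<in>T. P x \<longrightarrow> P y)"
  proof (intro exI[of _ T] conjI ballI impI)
    show "openin (top_of_set (id_component I)) T"
      by (auto simp: T_def openin_open)
    show "a \<in> T"
      using a \<epsilon> by (simp add: T_def)
    fix x x' assume x: "x \<in> T" "x' \<in> T" "P x"
    from log[OF x(1)] log[OF x(2)] obtain y y' where
      y: "y \<in> I" "x = a * exp (embed y)" and y': "y' \<in> I" "x' = a * exp (embed y')" by blast
    have "x * exp (embed (- y)) = a"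
      by (simp add: y(2) embed_algebra mult.assoc exp_minus_inverse)
    then have "P a"
      using mult_exp[of x "- y"] x y(1) closed_idealD(4)[OF I] by (auto simp: T_def)
    then show "P x'"
      using mult_exp[OF a _ y'(1)] y'(2) by simp
  qed
qed

lemma exp_id_component: "y \<in> I \<Longrightarrow> exp (embed y) \<in> id_component I"
  using mult_exp_id_component[OF one_id_component] by simp

lemma mult_id_component:
  assumes "g \<in> id_component I" "h \<in> id_component I"
  shows "g * h \<in> id_component I"
  using assms(2)
proof (induction h rule: id_component_induct)
  case one
  then show ?case using assms(1) by simp
next
  case (mult_exp h y)
  then show ?case
    using mult_exp_id_component[of "g * h" y] by (simp add: mult.assoc)
qed

lemma inverse_id_component:
  assumes "g \<in> id_component I"
  obtains k where "k \<in> id_component I" "g * k = 1" "k * g = 1"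
proof -
  have "\<exists>k\<in>id_component I. g * k = 1 \<and> k * g = 1"
    using assms
  proof (induction g rule: id_component_induct)
    case one
    then show ?case using one_id_component by auto
  next
    case (mult_exp g y)
    then obtain k where k: "k \<in> id_component I" "g * k = 1" "k * g = 1"
      by auto
    define e where "e = exp (embed (- y))"
    have e: "e \<in> id_component I" "exp (embed y) * e = 1" "e * exp (embed y) = 1"
      using mult_exp.hyps exp_id_component[of "- y"] closed_idealD(4)[OF I]
      by (simp_all add: e_def embed_algebra exp_minus_inverse exp_minus_inverse')
    have "g * exp (embed y) * (e * k) = g * (exp (embed y) * e) * k"
      "e * k * (g * exp (embed y)) = e * (k * g) * exp (embed y)"
      by (simp_all only: mult.assoc)
    then show ?case
      using e k by (intro bexI[of _ "e * k"] mult_id_component) simp_all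
  qed
  then show thesis
    using that by blast
qed

end

lemma id_component_mono: "I \<subseteq> J \<Longrightarrow> id_component I \<subseteq> id_component J"
  unfolding id_component_def by (intro connected_component_mono) (auto simp: invertibles_def)

section \<open>Commutators and brackets\<close>

abbreviation G\<^sub>U :: "'a::cstar_algebra unitized set" where
  "G\<^sub>U \<equiv> id_component UNIV"

lemma G_eq_one_embed:
  assumes "g \<in> G\<^sub>U"
  shows "g = 1 + embed (alg g)"
proof -
  from assms have "g - 1 \<in> range embed"
    using id_component_subset[OF closed_ideal_UNIV] by (auto simp: invertibles_def)
  then obtain x where "g - 1 = embed x" by auto
  then have "g = 1 + embed x" by (simp add: algebra_simps)
  then show ?thesis by simp
qed

lemma inverse_G_unique:
  assumes "g \<in> G\<^sub>U" "g * k = 1" "k * g = 1"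
  shows "k \<in> G\<^sub>U"
proof -
  from inverse_id_component[OF closed_ideal_UNIV assms(1)] obtain k' where
    k': "k' \<in> G\<^sub>U" "g * k' = 1" .
  have "k = k * (g * k')" by (simp add: k')
  also have "\<dots> = k'" by (simp add: assms flip: mult.assoc)
  finally show ?thesis using k'(1) by simp
qed

lemma closed_normal_subgroupI:
  assumes "1 \<in> N" "\<And>g h. g \<in> N \<Longrightarrow> h \<in> N \<Longrightarrow> g * h \<in> N"
    and "\<And>h g k. h \<in> N \<Longrightarrow> g \<in> G\<^sub>U \<Longrightarrow> k \<in> G\<^sub>U \<Longrightarrow> g * k = 1 \<Longrightarrow> k * g = 1 \<Longrightarrow> g * h * k \<in> N"
    and "\<And>f z. (\<And>n. f n \<in> N) \<Longrightarrow> f \<longlonglongrightarrow> z \<Longrightarrow> z \<in> G\<^sub>U \<Longrightarrow> z \<in> N"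
  shows "closed_normal_subgroup (range embed) G\<^sub>U N"
proof
  show "x \<in> range embed \<Longrightarrow> exp x \<in> G\<^sub>U" for x :: "'a unitized"
    using exp_id_component[OF closed_ideal_UNIV] by auto
  show "z \<in> N" if "\<And>n. f n \<in> N" "f \<longlonglongrightarrow> z" "z \<in> G\<^sub>U" for f z
    using that by (rule assms(4))
qed (fact assms(1-3) embed_ideal[OF closed_ideal_UNIV] mult_id_component[OF closed_ideal_UNIV])+

lemma bracket_embed:
  "(1 + embed z) * embed a - embed a * (1 + embed z) = embed (z * a - a * z)"
  by (simp add: algebra_simps embed_algebra)

text \<open>Let \<open>L\<close> be the tangent space of \<open>H\<close>. It is a closed Lie ideal containing \<open>[H, A]\<close>. Its core \<open>K\<close> contains
  \<open>[L, L]\<close>. For \<open>l \<in> L\<close> the square of the derivation \<open>[l, \<sqdot>]\<close> maps into \<open>[L, L]\<close>, so \<open>[L, A] \<subseteq> K\<close>; for \<open>h \<in> H\<close>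
  the square of \<open>[h, \<sqdot>]\<close> maps into \<open>[L, A]\<close>, so \<open>[H, A] \<subseteq> K\<close>. Hence \<open>I \<subseteq> K\<close> and \<open>[I, A] \<subseteq> L\<close>, which
  places the commutators of \<open>exp x\<close>, \<open>x \<in> I\<close>, in \<open>H\<close>; these exponentials generate the identity component.\<close>

theorem commutators_with_ideal_in_normal_subgroup:
  fixes H :: "'a::cstar_algebra unitized set"
  assumes H: "closed_normal_subgroup (range embed) G\<^sub>U H" "H \<subseteq> G\<^sub>U"
    and inv_H: "\<And>h k. h \<in> H \<Longrightarrow> h * k = 1 \<Longrightarrow> k * h = 1 \<Longrightarrow> k \<in> H"
    and I: "closed_ideal I"
    and least: "\<And>K. closed_ideal K \<Longrightarrow> (\<And>h a. h \<in> H \<Longrightarrow> alg h * a - a * alg h \<in> K) \<Longrightarrow> I \<subseteq> K"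
    and k: "k \<in> id_component I" "k * k' = 1" "k' * k = 1"
    and g: "g \<in> G\<^sub>U" "g * g' = 1" "g' * g = 1"
  shows "k * g * k' * g' \<in> H"
proof -
  interpret H: closed_normal_subgroup "range embed" "G\<^sub>U" H by fact
  define L where "L = embed -` H.tangent"
  have L: "subspace L" "closed L" "\<And>x a. x \<in> L \<Longrightarrow> a * x - x * a \<in> L"
  proof -
    show "subspace L"
      unfolding L_def by (intro linear_subspace_vimage bounded_linear.linear bounded_linear_embed H.subspace_tangent)
    show "closed L"
      unfolding L_def by (rule closed_vimage[OF H.closed_tangent linear_continuous_on[OF bounded_linear_embed]])
    show "x \<in> L \<Longrightarrow> a * x - x * a \<in> L" for x a
      using H.bracket_tangent[of "embed x" "embed a"] by (simp add: L_def embed_algebra)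
  qed
  define K where "K = lie_core L"
  have K: "closed_ideal K"
    unfolding K_def by (rule closed_ideal_lie_core[OF L])
  have bracket_H_L: "alg h * a - a * alg h \<in> L" if h: "h \<in> H" for h a
  proof -
    from h H(2) have hG: "h \<in> G\<^sub>U" by auto
    from inverse_id_component[OF closed_ideal_UNIV hG] obtain h' where
      h': "h' \<in> G\<^sub>U" "h * h' = 1" "h' * h = 1" .
    have "h * exp y * h' * exp (- y) \<in> H" if "y \<in> range embed" for y
      using H.mult_N[OF h H.conj_N[OF inv_H[OF h h'(2,3)] H.exp_inverse_G[OF that]]]
      by (simp add: mult.assoc)
    from H.bracket_in_tangent[OF h'(2,3) this, of "embed a"]
    have "(1 + embed (alg h)) * embed a - embed a * (1 + embed (alg h)) \<in> H.tangent"
      using G_eq_one_embed[OF hG] by simp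
    then show ?thesis
      unfolding bracket_embed by (simp add: L_def)
  qed
  note bracket_K = bracket_in_ideal[OF K semiprime_closed_ideal[OF K]]
  have bracket_L_K: "l * a - a * l \<in> K" if "l \<in> L" for l a
  proof (rule bracket_K)
    fix b
    have "l * b - b * l \<in> L"
      by (rule swapped_bracket_L[OF L(1,2)]) (use L(3) that in blast)+
    then show "l * (l * b - b * l) - (l * b - b * l) * l \<in> K"
      unfolding K_def by (intro bracket_in_lie_core[OF L(1,2)]) (use L(3) that in blast)+
  qed
  have "alg h * a - a * alg h \<in> K" if h: "h \<in> H" for h a
  proof (rule bracket_K)
    fix b
    have "- ((alg h * b - b * alg h) * alg h - alg h * (alg h * b - b * alg h)) \<in> K"
      by (intro closed_idealD(4)[OF K] bracket_L_K bracket_H_L h)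
    then show "alg h * (alg h * b - b * alg h) - (alg h * b - b * alg h) * alg h \<in> K"
      by simp
  qed
  then have "I \<subseteq> K"
    by (rule least[OF K])
  then have I_L: "x * a - a * x \<in> L" if "x \<in> I" for x a
    using that by (auto simp: K_def lie_core_def lie_normalizer_def)
  have exp_H: "exp (embed x) * g * exp (- embed x) * g' \<in> H" if x: "x \<in> I" for x
  proof (rule H.commutator_in_N(2)[OF g(2,3)])
    have g'G: "g' \<in> G\<^sub>U"
      by (rule inverse_G_unique[OF g])
    obtain z where z: "g = 1 + embed z"
      using G_eq_one_embed[OF g(1)] by blast
    have "embed x * g' \<in> embed ` I"
      using x by (intro embed_ideal[OF I]) auto
    then obtain y where y: "y \<in> I" "embed x * g' = embed y"
      by auto
    have "embed y * (1 + embed z) - (1 + embed z) * embed y = embed (y * z - z * y)"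
      by (simp add: algebra_simps embed_algebra)
    also have "\<dots> \<in> H.tangent"
      using I_L[OF y(1), of z] by (simp add: L_def)
    finally show "embed x * g' * g - g * (embed x * g') \<in> H.tangent"
      by (simp only: y(2) z)
  qed auto
  have "\<forall>k'. k * k' = 1 \<longrightarrow> k' * k = 1 \<longrightarrow> k * g * k' * g' \<in> H"
    using I k(1)
  proof (induction k rule: id_component_induct[consumes 2, case_names one mult_exp])
    case one
    then show ?case by (simp add: g H.one_N)
  next
    case (mult_exp k x)
    show ?case
    proof (intro allI impI)
      fix m assume m: "k * exp (embed x) * m = 1" "m * (k * exp (embed x)) = 1"
      define e e' where "e = exp (embed x)" and "e' = exp (- embed x)"
      have e: "e * e' = 1" "e' * e = 1"
        by (simp_all add: e_def e'_def exp_minus_inverse exp_minus_inverse')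
      define k' where "k' = e * m"
      have m_eq: "m = e' * k'"
        by (simp add: k'_def e flip: mult.assoc)
      have kk': "k * k' = 1"
        using m(1) by (simp add: k'_def e_def mult.assoc)
      have "k' * k = e * (m * (k * e)) * e'"
        by (simp add: k'_def mult.assoc e)
      then have k'k: "k' * k = 1"
        using m(2) by (simp add: e_def[symmetric] e)
      have kG: "k \<in> G\<^sub>U"
        using mult_exp.hyps id_component_mono[of I UNIV] by auto
      have "k * (e * g * e' * g') * k' \<in> H"
        using H.conj_N[OF _ kG inverse_G_unique[OF kG kk' k'k] kk' k'k] exp_H[OF mult_exp.hyps(2)]
        by (simp add: e_def e'_def)
      moreover have "k * g * k' * g' \<in> H"
        using mult_exp.IH kk' k'k by blast
      ultimately have "(k * (e * g * e' * g') * k') * (k * g * k' * g') \<in> H"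
        by (rule H.mult_N)
      also have "(k * (e * g * e' * g') * k') * (k * g * k' * g') =
          k * e * g * e' * (g' * (k' * k) * g) * k' * g'"
        by (simp only: mult.assoc)
      also have "\<dots> = k * e * g * m * g'"
        by (simp add: k'k g m_eq mult.assoc)
      finally show "k * exp (embed x) * g * m * g' \<in> H"
        by (simp add: e_def)
    qed
  qed
  then show ?thesis
    using k by blast
qed

text \<open>Differentiating the commutators of \<open>exp (t y)\<close>, \<open>y \<in> I\<close>, shows \<open>[I, A] \<subseteq> L\<close> for the tangent space
  \<open>L\<close> of \<open>N\<close>. Each \<open>[h, a]\<close> lies in \<open>I\<close>, hence in the closure of \<open>[I, A]\<close>, hence in \<open>L\<close>.\<close>

theorem commutators_of_elements_central_mod_ideal:
  fixes N :: "'a::cstar_algebra unitized set"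
  assumes N: "closed_normal_subgroup (range embed) G\<^sub>U N" and I: "closed_ideal I"
    and comm: "\<And>k k' g g'. k \<in> id_component I \<Longrightarrow> k * k' = 1 \<Longrightarrow> k' * k = 1 \<Longrightarrow>
      g \<in> G\<^sub>U \<Longrightarrow> g * g' = 1 \<Longrightarrow> g' * g = 1 \<Longrightarrow> k * g * k' * g' \<in> N"
    and h: "h \<in> G\<^sub>U" "h * h' = 1" "h' * h = 1" and central: "\<And>a. alg h * a - a * alg h \<in> I"
    and g: "g \<in> G\<^sub>U" "g * g' = 1" "g' * g = 1"
  shows "h * g * h' * g' \<in> N"
proof -
  interpret N: closed_normal_subgroup "range embed" "G\<^sub>U" N by fact
  have I_tangent: "embed (y * a - a * y) \<in> N.tangent" if y: "y \<in> I" for y a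
  proof -
    define k where "k = (\<lambda>n. exp (embed y /\<^sub>R real (Suc n)))"
    have "k n * embed a - embed a * k n \<in> N.tangent" for n
    proof (rule N.bracket_in_tangent)
      define k' where "k' = exp (- (embed y /\<^sub>R real (Suc n)))"
      show kk': "k n * k' = 1" "k' * k n = 1"
        by (simp_all add: k_def k'_def exp_minus_inverse exp_minus_inverse' del: of_nat_Suc)
      have "y /\<^sub>R real (Suc n) \<in> I"
        by (rule closed_idealD(6)[OF I y])
      from exp_id_component[OF I this] have kI: "k n \<in> id_component I"
        by (simp add: k_def embed_algebra del: of_nat_Suc)
      fix u assume u: "u \<in> range (embed :: 'a \<Rightarrow> _)"
      show "k n * exp u * k' * exp (- u) \<in> N"
        using N.exp_inverse_G[OF u] by (intro comm kI kk')
    qed simp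
    then have "real (Suc n) *\<^sub>R (k n * embed a - embed a * k n) \<in> N.tangent" for n
      by (rule subspace_scale[OF N.subspace_tangent])
    moreover have "(\<lambda>n. real (Suc n) *\<^sub>R (k n * embed a - embed a * k n)) \<longlonglongrightarrow> embed y * embed a - embed a * embed y"
    proof -
      have "(\<lambda>n. (real (Suc n) *\<^sub>R (k n - 1)) * embed a - embed a * (real (Suc n) *\<^sub>R (k n - 1)))
          \<longlonglongrightarrow> embed y * embed a - embed a * embed y"
        unfolding k_def by (intro tendsto_diff tendsto_mult exp_difference_quotient tendsto_const)
      then show ?thesis
        by (simp add: algebra_simps del: of_nat_Suc)
    qed
    ultimately have "embed y * embed a - embed a * embed y \<in> N.tangent"
      by (rule closed_sequentially[OF N.closed_tangent])
    then show ?thesis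
      by (simp add: embed_algebra)
  qed
  have closed: "closed (embed -` N.tangent)"
    by (rule closed_vimage[OF N.closed_tangent linear_continuous_on[OF bounded_linear_embed]])
  have h_tangent: "embed a * h - h * embed a \<in> N.tangent" for a
  proof -
    have "alg h * a - a * alg h \<in> embed -` N.tangent"
      by (rule bracket_in_closure[OF I closed _ central]) (simp add: I_tangent)
    then have "- embed (alg h * a - a * alg h) \<in> N.tangent"
      by (intro subspace_neg[OF N.subspace_tangent]) simp
    also have "- embed (alg h * a - a * alg h) = - ((1 + embed (alg h)) * embed a - embed a * (1 + embed (alg h)))"
      by (simp only: bracket_embed)
    also have "\<dots> = embed a * h - h * embed a"
      using G_eq_one_embed[OF h(1)] by simp
    finally show ?thesis .
  qed
  have exp_N: "h * exp u * h' * exp (- u) \<in> N" if u: "u \<in> range embed" for u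
  proof (rule N.commutator_in_N(1)[OF h(2,3) u])
    have "u * h' \<in> range embed"
      using u by (rule embed_ideal(4)[OF closed_ideal_UNIV])
    then show "u * h' * h - h * (u * h') \<in> N.tangent"
      using h_tangent by auto
  qed
  have "\<forall>g'. g * g' = 1 \<longrightarrow> g' * g = 1 \<longrightarrow> h * g * h' * g' \<in> N"
    using closed_ideal_UNIV g(1)
  proof (induction g rule: id_component_induct[consumes 2, case_names one mult_exp])
    case one
    then show ?case by (simp add: h N.one_N)
  next
    case (mult_exp g x)
    show ?case
    proof (intro allI impI)
      fix m assume m: "g * exp (embed x) * m = 1" "m * (g * exp (embed x)) = 1"
      define e e' where "e = exp (embed x)" and "e' = exp (- embed x)"
      have e: "e * e' = 1" "e' * e = 1"
        by (simp_all add: e_def e'_def exp_minus_inverse exp_minus_inverse')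
      define g' where "g' = e * m"
      have m_eq: "m = e' * g'"
        by (simp add: g'_def e flip: mult.assoc)
      have gg': "g * g' = 1"
        using m(1) by (simp add: g'_def e_def mult.assoc)
      have "g' * g = e * (m * (g * e)) * e'"
        by (simp add: g'_def mult.assoc e)
      then have g'g: "g' * g = 1"
        using m(2) by (simp add: e_def[symmetric] e)
      have "g * (h * e * h' * e') * g' \<in> N"
        using N.conj_N[OF _ mult_exp.hyps(1) inverse_G_unique[OF mult_exp.hyps(1) gg' g'g] gg' g'g]
          exp_N[of "embed x"] by (simp add: e_def e'_def)
      moreover have "h * g * h' * g' \<in> N"
        using mult_exp.IH gg' g'g by blast
      ultimately have "(h * g * h' * g') * (g * (h * e * h' * e') * g') \<in> N"
        by (rule N.mult_N[rotated])
      also have "(h * g * h' * g') * (g * (h * e * h' * e') * g') =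
          h * g * (h' * (g' * g) * h) * e * h' * e' * g'"
        by (simp only: mult.assoc)
      also have "\<dots> = h * (g * e) * h' * m"
        by (simp add: g'g h m_eq mult.assoc)
      finally show "h * (g * exp (embed x)) * h' * m \<in> N"
        by (simp add: e_def)
    qed
  qed
  then show ?thesis
    using g by blast
qed

section \<open>Transfer to the minimal unitization\<close>

definition to_pair :: "'a::cstar_algebra unitized \<Rightarrow> 'a \<times> complex" where
  "to_pair u = \<one>\<^bsub>unitization\<^esub> + emb (alg u)"

definition of_pair :: "'a::cstar_algebra \<times> complex \<Rightarrow> 'a unitized" where
  "of_pair p = 1 + embed (fst p - fst \<one>\<^bsub>unitization :: ('a \<times> complex) monoid\<^esub>)"

lemma emb_add: "emb (x + y) = emb x + emb (y :: 'a::cstar_algebra)"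
  by (simp add: emb_def)

lemma umult_one:
  assumes "u \<in> carrier (unitization :: ('a::cstar_algebra \<times> complex) monoid)"
  shows "umult \<one>\<^bsub>unitization\<^esub> u = u" "umult u \<one>\<^bsub>unitization\<^esub> = u"
  using monoid.l_one[OF monoid_unitization assms] monoid.r_one[OF monoid_unitization assms] by simp_all

lemma umult_one_emb:
  "umult \<one>\<^bsub>unitization\<^esub> (emb x) = emb (x :: 'a::cstar_algebra)" "umult (emb x) \<one>\<^bsub>unitization\<^esub> = emb x"
  by (rule umult_one; simp add: carrier_unitization emb_def)+

lemma to_pair_one [simp]: "to_pair 1 = \<one>\<^bsub>unitization\<^esub>"
  by (simp add: to_pair_def emb_def zero_prod_def[symmetric])

lemma to_pair_mult:
  fixes u v :: "'a::cstar_algebra unitized"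
  assumes "scal u = 1" "scal v = 1"
  shows "to_pair (u * v) = umult (to_pair u) (to_pair v)"
proof -
  have one: "umult \<one>\<^bsub>unitization\<^esub> \<one>\<^bsub>unitization\<^esub> = (\<one>\<^bsub>unitization\<^esub> :: 'a \<times> complex)"
    using monoid.l_one[OF monoid_unitization monoid.one_closed[OF monoid_unitization]] by simp
  show ?thesis
    by (simp add: to_pair_def umult_add_left umult_add_right one umult_one_emb umult_emb emb_add assms add_ac
        scaleC.scale_one)
qed

lemma of_pair_to_pair: "scal u = 1 \<Longrightarrow> of_pair (to_pair u) = (u :: 'a::cstar_algebra unitized)"
  by (simp add: of_pair_def to_pair_def unitized_eq_iff emb_def)

lemma to_pair_of_pair:
  fixes p :: "'a::cstar_algebra \<times> complex"
  assumes "snd p = snd \<one>\<^bsub>unitization :: ('a \<times> complex) monoid\<^esub>"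
  shows "to_pair (of_pair p) = p"
  using assms by (simp add: of_pair_def to_pair_def emb_def prod_eq_iff)

lemma continuous_to_pair: "continuous_on S (to_pair :: 'a::cstar_algebra unitized \<Rightarrow> _)"
  unfolding to_pair_def emb_def
  by (intro continuous_on_add continuous_on_const continuous_on_Pair linear_continuous_on bounded_linear_alg)

lemma continuous_of_pair: "continuous_on S (of_pair :: 'a::cstar_algebra \<times> complex \<Rightarrow> _)"
  unfolding of_pair_def
  by (intro continuous_on_add continuous_on_const bounded_linear.continuous_on[OF bounded_linear_embed]
      continuous_on_diff continuous_on_fst continuous_on_id)

lemma scal_invertibles: "u \<in> invertibles I \<Longrightarrow> scal u = 1"
proof -
  assume "u \<in> invertibles I"
  then obtain x where "u - 1 = embed x" by (auto simp: invertibles_def)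
  then have "scal (u - 1) = 0" by simp
  then show "scal u = 1" by simp
qed

context
  fixes I :: "'a::cstar_algebra set"
  assumes I: "closed_ideal I"
begin

text \<open>The inverse \<open>k\<close> of \<open>1 + x\<close> satisfies \<open>k - 1 = - k x\<close>, so an inverse in the whole algebra
  automatically differs from \<open>1\<close> by an element of the ideal.\<close>

lemma GL_ideal_eq: "GL_ideal I = to_pair ` invertibles I"
proof (intro subset_antisym subsetI)
  let ?one = "\<one>\<^bsub>unitization\<^esub> :: 'a \<times> complex"
  have sub: "carrier (ideal_unitization I) \<subseteq> carrier (unitization :: ('a \<times> complex) monoid)"
    by (auto simp: ideal_unitization_def carrier_unitization snd_one_unitization uscale_def emb_def)
  have fields: "monoid.mult (ideal_unitization I) = umult" "\<one>\<^bsub>ideal_unitization I\<^esub> = ?one"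
    by (simp_all add: ideal_unitization_def)
  fix p assume "p \<in> GL_ideal I"
  then obtain x q where x: "x \<in> I" "p = ?one + emb x" and q: "q \<in> carrier (ideal_unitization I)"
    "umult p q = ?one" "umult q p = ?one"
    unfolding GL_ideal_def Units_def fields by blast
  have qc: "q \<in> carrier (unitization :: ('a \<times> complex) monoid)"
    using q(1) sub by blast
  have "snd p * snd q = snd ?one"
    using q(2) by (metis snd_umult)
  then have "snd q = snd ?one"
    using qc x(2) by (auto simp: snd_one_unitization carrier_unitization emb_def)
  then have qp: "to_pair (of_pair q) = q"
    by (rule to_pair_of_pair)
  have pp: "to_pair (1 + embed x) = p"
    by (simp add: to_pair_def x)
  have scal: "scal (of_pair q) = 1"
    by (simp add: of_pair_def)
  have inv: "(1 + embed x) * of_pair q = 1" "of_pair q * (1 + embed x) = 1"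
    using to_pair_mult[of "1 + embed x" "of_pair q"] to_pair_mult[of "of_pair q" "1 + embed x"] q scal
      of_pair_to_pair[of "(1 + embed x) * of_pair q"] of_pair_to_pair[of "of_pair q * (1 + embed x)"]
      of_pair_to_pair[of "1 :: 'a unitized"]
    by (simp_all add: qp pp)
  then have "1 + embed x \<in> invertibles I"
    using x(1) by (auto simp: invertibles_def)
  then show "p \<in> to_pair ` invertibles I"
    using pp by blast
next
  let ?one = "\<one>\<^bsub>unitization\<^esub> :: 'a \<times> complex"
  have fields: "monoid.mult (ideal_unitization I) = umult" "\<one>\<^bsub>ideal_unitization I\<^esub> = ?one"
    by (simp_all add: ideal_unitization_def)
  have mem: "?one + emb x \<in> carrier (ideal_unitization I)" if "x \<in> I" for x
    using that unfolding ideal_unitization_def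
    by (auto intro!: exI[of _ 1] exI[of _ x] simp: uscale_def scaleC.scale_one)
  fix p assume "p \<in> to_pair ` invertibles I"
  then obtain g where g: "p = to_pair g" "g \<in> invertibles I"
    by blast
  then obtain x k where x: "x \<in> I" "g - 1 = embed x" and k: "g * k = 1" "k * g = 1"
    by (auto simp: invertibles_def)
  have g_eq: "g = 1 + embed x"
    using x(2) by (simp add: algebra_simps)
  have p: "p = to_pair (1 + embed x)"
    using g(1) by (simp only: g_eq)
  note k = k[unfolded g_eq]
  have "k - 1 = - (k * embed x)"
    using k(2) by (simp add: algebra_simps)
  moreover have "- (k * embed x) \<in> embed ` I"
    using x by (intro subspace_neg embed_ideal[OF I]) auto
  ultimately obtain y where y: "y \<in> I" "k - 1 = embed y"
    by auto
  then have ky: "k = 1 + embed y"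
    by (simp add: algebra_simps)
  have "umult (to_pair (1 + embed x)) (to_pair (1 + embed y)) = ?one"
    "umult (to_pair (1 + embed y)) (to_pair (1 + embed x)) = ?one"
    using k by (simp_all flip: to_pair_mult add: ky)
  moreover have "to_pair (1 + embed x) = ?one + emb x" "to_pair (1 + embed y) = ?one + emb y"
    by (simp_all add: to_pair_def)
  ultimately show "p \<in> GL_ideal I"
    unfolding GL_ideal_def Units_def fields p using mem[OF x(1)] mem[OF y(1)] x(1) by auto
qed

lemma G_ideal_eq: "G_ideal I = to_pair ` id_component I"
proof (rule subset_antisym)
  have "of_pair ` G_ideal I \<subseteq> id_component I"
    unfolding id_component_def
  proof (rule connected_component_maximal)
    have "\<one>\<^bsub>unitization\<^esub> \<in> GL_ideal I"
      unfolding GL_ideal_eq using one_invertibles[OF I] by (intro image_eqI[of _ _ 1]) simp_all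
    then have "\<one>\<^bsub>unitization\<^esub> \<in> G_ideal I"
      by (simp add: G_ideal_def)
    then show "1 \<in> of_pair ` G_ideal I"
      using of_pair_to_pair[of "1 :: 'a unitized"] by (metis alg_scal(4) image_eqI to_pair_one)
    show "connected (of_pair ` G_ideal I)"
      unfolding G_ideal_def by (intro connected_continuous_image continuous_of_pair connected_connected_component)
    have "G_ideal I \<subseteq> GL_ideal I"
      unfolding G_ideal_def by (rule connected_component_subset)
    then show "of_pair ` G_ideal I \<subseteq> invertibles I"
      unfolding GL_ideal_eq by (force simp: of_pair_to_pair scal_invertibles)
  qed
  then have "to_pair ` of_pair ` G_ideal I \<subseteq> to_pair ` id_component I"
    by blast
  moreover have "to_pair (of_pair p) = p" if "p \<in> G_ideal I" for p
  proof -
    have "p \<in> GL_ideal I"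
      using that connected_component_subset unfolding G_ideal_def by blast
    then show ?thesis
      unfolding GL_ideal_eq by (auto simp: of_pair_to_pair scal_invertibles)
  qed
  ultimately show "G_ideal I \<subseteq> to_pair ` id_component I"
    by (force simp: image_image)
  show "to_pair ` id_component I \<subseteq> G_ideal I"
    unfolding G_ideal_def
  proof (rule connected_component_maximal)
    show "\<one>\<^bsub>unitization\<^esub> \<in> to_pair ` id_component I"
      using one_id_component[OF I] by (intro image_eqI[of _ _ 1]) simp_all
    show "connected (to_pair ` id_component I)"
      unfolding id_component_def
      by (intro connected_continuous_image continuous_to_pair connected_connected_component)
    show "to_pair ` id_component I \<subseteq> GL_ideal I"
      unfolding GL_ideal_eq by (intro image_mono id_component_subset[OF I])
  qed
qed

end

lemma carrier_G_A: "carrier (G_A :: ('a::cstar_algebra \<times> complex) monoid) = to_pair ` G\<^sub>U"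
  using G_ideal_eq[OF closed_ideal_UNIV] by (simp add: G_A_def G_ideal_def GL_ideal_UNIV)

lemma mult_G_A: "monoid.mult G_A = umult" and one_G_A: "\<one>\<^bsub>G_A\<^esub> = \<one>\<^bsub>unitization\<^esub>"
  by (simp_all add: G_A_def)

lemma scal_G: "u \<in> G\<^sub>U \<Longrightarrow> scal u = 1"
  using id_component_subset[OF closed_ideal_UNIV] scal_invertibles by blast

lemma to_pair_G: "u \<in> G\<^sub>U \<Longrightarrow> to_pair u \<in> carrier G_A"
  by (simp add: carrier_G_A)

lemma to_pair_G_mult:
  "u \<in> G\<^sub>U \<Longrightarrow> v \<in> G\<^sub>U \<Longrightarrow> to_pair (u * v) = to_pair u \<otimes>\<^bsub>G_A\<^esub> to_pair v"
  by (simp add: mult_G_A to_pair_mult scal_G)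

lemma to_pair_G_inv:
  assumes "u \<in> G\<^sub>U" "u * v = 1" "v * u = 1"
  shows "inv\<^bsub>G_A\<^esub> (to_pair u) = to_pair v"
proof (rule group.inv_equality[OF group_G_A])
  have v: "v \<in> G\<^sub>U"
    by (rule inverse_G_unique[OF assms])
  then show "to_pair v \<otimes>\<^bsub>G_A\<^esub> to_pair u = \<one>\<^bsub>G_A\<^esub>"
    using to_pair_G_mult[OF v assms(1)] assms by (simp add: one_G_A)
  show "to_pair u \<in> carrier G_A" "to_pair v \<in> carrier G_A"
    using v assms by (simp_all add: to_pair_G)
qed

lemma to_pair_commutator:
  assumes k: "k \<in> G\<^sub>U" "k * k' = 1" "k' * k = 1" and g: "g \<in> G\<^sub>U" "g * g' = 1" "g' * g = 1"
  shows "to_pair (k * g * k' * g') =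
    to_pair k \<otimes>\<^bsub>G_A\<^esub> to_pair g \<otimes>\<^bsub>G_A\<^esub> inv\<^bsub>G_A\<^esub> (to_pair k) \<otimes>\<^bsub>G_A\<^esub> inv\<^bsub>G_A\<^esub> (to_pair g)"
  using inverse_G_unique[OF k] inverse_G_unique[OF g] k(1) g(1)
  by (simp add: to_pair_G_inv[OF k] to_pair_G_inv[OF g] to_pair_G_mult mult_id_component[OF closed_ideal_UNIV])

lemma pull_back_closed_normal:
  fixes N :: "('a::cstar_algebra \<times> complex) set"
  assumes one: "\<one>\<^bsub>G_A\<^esub> \<in> N" and mult: "\<And>p q. p \<in> N \<Longrightarrow> q \<in> N \<Longrightarrow> p \<otimes>\<^bsub>G_A\<^esub> q \<in> N"
    and conj: "\<And>p q. p \<in> N \<Longrightarrow> q \<in> carrier G_A \<Longrightarrow> q \<otimes>\<^bsub>G_A\<^esub> p \<otimes>\<^bsub>G_A\<^esub> inv\<^bsub>G_A\<^esub> q \<in> N"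
    and closed: "closedin (top_of_set (carrier G_A)) N"
  shows "closed_normal_subgroup (range embed) G\<^sub>U {u \<in> G\<^sub>U. to_pair u \<in> N}"
proof (rule closed_normal_subgroupI)
  show "1 \<in> {u \<in> G\<^sub>U. to_pair u \<in> N}"
    using one one_id_component[OF closed_ideal_UNIV] by (simp add: one_G_A)
  show "g * h \<in> {u \<in> G\<^sub>U. to_pair u \<in> N}"
    if "g \<in> {u \<in> G\<^sub>U. to_pair u \<in> N}" "h \<in> {u \<in> G\<^sub>U. to_pair u \<in> N}" for g h
    using that mult by (simp add: to_pair_G_mult mult_id_component[OF closed_ideal_UNIV])
  show "g * h * k \<in> {u \<in> G\<^sub>U. to_pair u \<in> N}"
    if "h \<in> {u \<in> G\<^sub>U. to_pair u \<in> N}" "g \<in> G\<^sub>U" "k \<in> G\<^sub>U" "g * k = 1" "k * g = 1" for h g k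
    using that conj[of "to_pair h" "to_pair g"]
    by (simp add: to_pair_G_mult mult_id_component[OF closed_ideal_UNIV] to_pair_G_inv to_pair_G)
  show "z \<in> {u \<in> G\<^sub>U. to_pair u \<in> N}"
    if f: "\<And>n. f n \<in> {u \<in> G\<^sub>U. to_pair u \<in> N}" "f \<longlonglongrightarrow> z" "z \<in> G\<^sub>U" for f z
  proof -
    obtain T where T: "closed T" "N = carrier G_A \<inter> T"
      using closed by (auto simp: closedin_closed)
    have lim: "(\<lambda>n. to_pair (f n)) \<longlonglongrightarrow> to_pair z"
      using continuous_on_tendsto_compose[OF continuous_to_pair[of UNIV] f(2)] by simp
    have "to_pair (f n) \<in> T" for n
      using f(1)[of n] T(2) by simp
    then have "to_pair z \<in> T"
      using lim by (rule closed_sequentially[OF T(1)])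
    then show ?thesis
      using T(2) f(3) by (simp add: to_pair_G)
  qed
qed

section \<open>The commutator subgroups\<close>

text \<open>Conjugates of \<open>(k, g)\<close> are thus expressed by commutators with the same first entry.\<close>

lemma (in group) conj_commutator:
  assumes "k \<in> carrier G" "g \<in> carrier G" "s \<in> carrier G"
  shows "s \<otimes> (k \<otimes> g \<otimes> inv k \<otimes> inv g) \<otimes> inv s =
    inv (k \<otimes> s \<otimes> inv k \<otimes> inv s) \<otimes> (k \<otimes> (s \<otimes> g) \<otimes> inv k \<otimes> inv (s \<otimes> g))"
proof -
  have cancel: "inv x \<otimes> (x \<otimes> y) = y" "x \<otimes> (inv x \<otimes> y) = y" if "x \<in> carrier G" "y \<in> carrier G" for x y
    using that by (simp_all flip: m_assoc)
  show ?thesis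
    using assms by (simp add: m_assoc inv_mult_group cancel)
qed

text \<open>The inverse of a commutator is conjugate to a commutator with the same first entry, so
  invariance under conjugation can replace continuity of the inversion.\<close>

lemma (in group) inv_commutator:
  assumes "k \<in> carrier G" "g \<in> carrier G"
  shows "inv (k \<otimes> g \<otimes> inv k \<otimes> inv g) = g \<otimes> (k \<otimes> inv g \<otimes> inv k \<otimes> inv (inv g)) \<otimes> inv g"
  using assms by (simp add: m_assoc inv_mult_group)

abbreviation commutator :: "'a::cstar_algebra \<times> complex \<Rightarrow> 'a \<times> complex \<Rightarrow> 'a \<times> complex" where
  "commutator x y \<equiv> x \<otimes>\<^bsub>G_A\<^esub> y \<otimes>\<^bsub>G_A\<^esub> inv\<^bsub>G_A\<^esub> x \<otimes>\<^bsub>G_A\<^esub> inv\<^bsub>G_A\<^esub> y"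

interpretation G_A: group "G_A :: ('a::cstar_algebra \<times> complex) monoid"
  by (rule group_G_A)

lemma comm_subgroup_conj:
  fixes X :: "('a::cstar_algebra \<times> complex) set"
  assumes X: "X \<subseteq> carrier G_A" and s: "s \<in> carrier G_A" and x: "x \<in> comm_subgroup X (carrier G_A)"
  shows "s \<otimes>\<^bsub>G_A\<^esub> x \<otimes>\<^bsub>G_A\<^esub> inv\<^bsub>G_A\<^esub> s \<in> comm_subgroup X (carrier G_A)"
proof -
  define S where "S = {commutator x y | x y. x \<in> X \<and> y \<in> carrier G_A}"
  have S: "S \<subseteq> carrier G_A"
    using X by (auto simp: S_def)
  have gen: "comm_subgroup X (carrier G_A) = generate G_A S"
    by (simp add: comm_subgroup_def S_def)
  have carrier: "y \<in> carrier G_A" if "y \<in> generate G_A S" for y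
    using that G_A.generate_in_carrier[OF S] by blast
  have incl: "s \<otimes>\<^bsub>G_A\<^esub> y \<otimes>\<^bsub>G_A\<^esub> inv\<^bsub>G_A\<^esub> s \<in> generate G_A S" if "y \<in> S" for y
  proof -
    from that obtain k g where kg: "k \<in> X" "g \<in> carrier G_A" "y = commutator k g"
      by (auto simp: S_def)
    have "commutator k s \<in> S" "commutator k (s \<otimes>\<^bsub>G_A\<^esub> g) \<in> S"
      using kg s G_A.m_closed[of s g] unfolding S_def by blast+
    then show ?thesis
      using kg X s by (subst kg(3), subst G_A.conj_commutator) (auto intro: generate.eng generate.inv generate.incl)
  qed
  show ?thesis
    using x unfolding gen
  proof (induction x rule: generate.induct)
    case one
    then show ?case using s by (simp add: generate.one)
  next
    case (incl h)
    then show ?case by (rule \<open>\<And>y. y \<in> S \<Longrightarrow> _\<close>)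
  next
    case (inv h)
    then have "inv\<^bsub>G_A\<^esub> (s \<otimes>\<^bsub>G_A\<^esub> h \<otimes>\<^bsub>G_A\<^esub> inv\<^bsub>G_A\<^esub> s) \<in> generate G_A S"
      by (intro G_A.generate_m_inv_closed[OF S] \<open>\<And>y. y \<in> S \<Longrightarrow> _\<close>)
    then show ?case
      using inv S s by (auto simp: G_A.inv_mult_group G_A.m_assoc)
  next
    case (eng h1 h2)
    have c: "h1 \<in> carrier G_A" "h2 \<in> carrier G_A"
      using eng.hyps by (simp_all add: carrier)
    have "(s \<otimes>\<^bsub>G_A\<^esub> h1 \<otimes>\<^bsub>G_A\<^esub> inv\<^bsub>G_A\<^esub> s) \<otimes>\<^bsub>G_A\<^esub> (s \<otimes>\<^bsub>G_A\<^esub> h2 \<otimes>\<^bsub>G_A\<^esub> inv\<^bsub>G_A\<^esub> s) \<in> generate G_A S"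
      using eng.IH by (rule generate.eng)
    also have "(s \<otimes>\<^bsub>G_A\<^esub> h1 \<otimes>\<^bsub>G_A\<^esub> inv\<^bsub>G_A\<^esub> s) \<otimes>\<^bsub>G_A\<^esub> (s \<otimes>\<^bsub>G_A\<^esub> h2 \<otimes>\<^bsub>G_A\<^esub> inv\<^bsub>G_A\<^esub> s) =
        s \<otimes>\<^bsub>G_A\<^esub> (h1 \<otimes>\<^bsub>G_A\<^esub> ((inv\<^bsub>G_A\<^esub> s \<otimes>\<^bsub>G_A\<^esub> s) \<otimes>\<^bsub>G_A\<^esub> h2)) \<otimes>\<^bsub>G_A\<^esub> inv\<^bsub>G_A\<^esub> s"
      using c s by (simp only: G_A.m_assoc G_A.m_closed G_A.inv_closed)
    also have "\<dots> = s \<otimes>\<^bsub>G_A\<^esub> (h1 \<otimes>\<^bsub>G_A\<^esub> h2) \<otimes>\<^bsub>G_A\<^esub> inv\<^bsub>G_A\<^esub> s"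
      using c s by simp
    finally show ?case .
  qed
qed

lemma tendsto_umult:
  fixes f g :: "nat \<Rightarrow> 'a::cstar_algebra \<times> complex"
  assumes f: "f \<longlonglongrightarrow> p" "\<And>n. f n \<in> carrier G_A" "p \<in> carrier G_A"
    and g: "g \<longlonglongrightarrow> q" "\<And>n. g n \<in> carrier G_A" "q \<in> carrier G_A"
  shows "(\<lambda>n. f n \<otimes>\<^bsub>G_A\<^esub> g n) \<longlonglongrightarrow> p \<otimes>\<^bsub>G_A\<^esub> q"
proof -
  have mult: "to_pair (of_pair x * of_pair y) = x \<otimes>\<^bsub>G_A\<^esub> y" if "x \<in> carrier G_A" "y \<in> carrier G_A"
    for x y :: "'a \<times> complex"
    using that by (auto simp: carrier_G_A of_pair_to_pair scal_G to_pair_G_mult)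
  have "(\<lambda>n. of_pair (f n) * of_pair (g n)) \<longlonglongrightarrow> of_pair p * of_pair q"
    using continuous_on_tendsto_compose[OF continuous_of_pair[of UNIV] f(1)]
      continuous_on_tendsto_compose[OF continuous_of_pair[of UNIV] g(1)]
    by (intro tendsto_mult) simp_all
  then have "(\<lambda>n. to_pair (of_pair (f n) * of_pair (g n))) \<longlonglongrightarrow> to_pair (of_pair p * of_pair q)"
    using continuous_on_tendsto_compose[OF continuous_to_pair[of UNIV]] by fastforce
  then show ?thesis
    using f g by (simp add: mult)
qed

context
  fixes I :: "'a::cstar_algebra set"
  assumes I: "closed_ideal I"
begin

lemma G_ideal_subset: "G_ideal I \<subseteq> carrier G_A"
  unfolding G_ideal_eq[OF I] carrier_G_A by (intro image_mono id_component_mono) simp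

lemma comm_subgroup_carrier: "comm_subgroup (G_ideal I) (carrier G_A) \<subseteq> carrier G_A"
  unfolding comm_subgroup_def using G_ideal_subset by (intro G_A.generate_incl) auto

lemma closed_comm_subgroup_iff:
  "p \<in> closed_comm_subgroup I \<longleftrightarrow>
    p \<in> carrier G_A \<and> (\<exists>f. (\<forall>n. f n \<in> comm_subgroup (G_ideal I) (carrier G_A)) \<and> f \<longlonglongrightarrow> p)"
proof -
  have "closed_comm_subgroup I = carrier G_A \<inter> closure (comm_subgroup (G_ideal I) (carrier G_A))"
    using comm_subgroup_carrier
    by (simp add: closed_comm_subgroup_def closure_of_subtopology Int_absorb1)
  then show ?thesis
    by (auto simp: closure_sequential)
qed

lemma closed_comm_subgroup_normal:
  "\<one>\<^bsub>G_A\<^esub> \<in> closed_comm_subgroup I"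
  "p \<in> closed_comm_subgroup I \<Longrightarrow> q \<in> closed_comm_subgroup I \<Longrightarrow> p \<otimes>\<^bsub>G_A\<^esub> q \<in> closed_comm_subgroup I"
  "p \<in> closed_comm_subgroup I \<Longrightarrow> s \<in> carrier G_A \<Longrightarrow> s \<otimes>\<^bsub>G_A\<^esub> p \<otimes>\<^bsub>G_A\<^esub> inv\<^bsub>G_A\<^esub> s \<in> closed_comm_subgroup I"
proof -
  let ?C = "comm_subgroup (G_ideal I) (carrier G_A)"
  have carrier: "x \<in> carrier G_A" if "x \<in> ?C" for x
    using that comm_subgroup_carrier by blast
  have "\<one>\<^bsub>G_A\<^esub> \<in> ?C"
    by (simp add: comm_subgroup_def generate.one)
  then show "\<one>\<^bsub>G_A\<^esub> \<in> closed_comm_subgroup I"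
    unfolding closed_comm_subgroup_iff by (auto intro!: exI[of _ "\<lambda>_. \<one>\<^bsub>G_A\<^esub>"])
  show "p \<otimes>\<^bsub>G_A\<^esub> q \<in> closed_comm_subgroup I"
    if pq: "p \<in> closed_comm_subgroup I" "q \<in> closed_comm_subgroup I"
  proof -
    from pq obtain f g where f: "\<And>n. f n \<in> ?C" "f \<longlonglongrightarrow> p" and g: "\<And>n. g n \<in> ?C" "g \<longlonglongrightarrow> q"
      and c: "p \<in> carrier G_A" "q \<in> carrier G_A"
      unfolding closed_comm_subgroup_iff by blast
    have "f n \<otimes>\<^bsub>G_A\<^esub> g n \<in> ?C" for n
      using f(1) g(1) unfolding comm_subgroup_def by (rule generate.eng)
    then show ?thesis
      unfolding closed_comm_subgroup_iff using tendsto_umult[OF f(2) _ c(1) g(2) _ c(2)] f(1) g(1) c carrier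
      by (auto intro!: exI[of _ "\<lambda>n. f n \<otimes>\<^bsub>G_A\<^esub> g n"])
  qed
  show "s \<otimes>\<^bsub>G_A\<^esub> p \<otimes>\<^bsub>G_A\<^esub> inv\<^bsub>G_A\<^esub> s \<in> closed_comm_subgroup I"
    if p: "p \<in> closed_comm_subgroup I" and s: "s \<in> carrier G_A"
  proof -
    from p obtain f where f: "\<And>n. f n \<in> ?C" "f \<longlonglongrightarrow> p" and c: "p \<in> carrier G_A"
      unfolding closed_comm_subgroup_iff by blast
    have "s \<otimes>\<^bsub>G_A\<^esub> f n \<otimes>\<^bsub>G_A\<^esub> inv\<^bsub>G_A\<^esub> s \<in> ?C" for n
      by (rule comm_subgroup_conj[OF G_ideal_subset s f(1)])
    moreover have "(\<lambda>n. s \<otimes>\<^bsub>G_A\<^esub> f n \<otimes>\<^bsub>G_A\<^esub> inv\<^bsub>G_A\<^esub> s) \<longlonglongrightarrow> s \<otimes>\<^bsub>G_A\<^esub> p \<otimes>\<^bsub>G_A\<^esub> inv\<^bsub>G_A\<^esub> s"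
      using f c s carrier by (intro tendsto_umult tendsto_const) auto
    ultimately show ?thesis
      unfolding closed_comm_subgroup_iff using c s
      by (intro conjI exI[of _ "\<lambda>n. s \<otimes>\<^bsub>G_A\<^esub> f n \<otimes>\<^bsub>G_A\<^esub> inv\<^bsub>G_A\<^esub> s"]) auto
  qed
qed

end

lemma comm_subset_closed_comm:
  fixes I :: "'a::cstar_algebra set"
  assumes "closed_ideal I"
  shows "comm_subgroup (G_ideal I) (carrier G_A) \<subseteq> closed_comm_subgroup I"
  unfolding closed_comm_subgroup_def
  using closure_of_subset[of _ "top_of_set (carrier G_A)"] comm_subgroup_carrier[OF assms] by simp

lemma bracket_to_pair:
  "umult (to_pair h) (emb a) - umult (emb a) (to_pair h) = emb (alg h * a - a * alg (h :: 'a::cstar_algebra unitized))"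
  by (simp add: to_pair_def umult_add_left umult_add_right umult_one_emb umult_emb) (simp add: emb_def)

lemma carrier_G_AE:
  assumes "p \<in> carrier G_A"
  obtains u v where "p = to_pair u" "u \<in> G\<^sub>U" "u * v = 1" "v * u = 1"
  using assms inverse_id_component[OF closed_ideal_UNIV] unfolding carrier_G_A by blast

lemma comm_subgroup_singleton_subset:
  fixes I :: "'a::cstar_algebra set"
  assumes I: "closed_ideal I" and h: "h \<in> carrier G_A"
    and N: "\<And>g. g \<in> carrier G_A \<Longrightarrow> commutator h g \<in> closed_comm_subgroup I"
  shows "comm_subgroup {h} (carrier G_A) \<subseteq> closed_comm_subgroup I"
proof
  fix x assume "x \<in> comm_subgroup {h} (carrier G_A)"
  then show "x \<in> closed_comm_subgroup I"
    unfolding comm_subgroup_def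
  proof (induction x rule: generate.induct)
    case one
    then show ?case by (rule closed_comm_subgroup_normal(1)[OF I])
  next
    case (incl x)
    then show ?case using N by blast
  next
    case (inv x)
    then obtain g where g: "g \<in> carrier G_A" "x = commutator h g"
      by blast
    show ?case
      unfolding g(2) G_A.inv_commutator[OF h g(1)]
      using g(1) by (intro closed_comm_subgroup_normal(3)[OF I] N) simp_all
  next
    case (eng x y)
    show ?case by (rule closed_comm_subgroup_normal(2)[OF I eng.IH])
  qed
qed

text \<open>Both inclusions are pulled back along \<open>to_pair\<close>: the first for \<open>H\<close>, the second for the closure of
  \<open>(G\<^sub>I, G\<^sub>A)\<close>, which is itself a closed normal subgroup.\<close>

theorem closed_normal_subgroup_sandwich:
  fixes H :: "('a::cstar_algebra \<times> complex) set"
  assumes normal: "H \<lhd> G_A" and closed: "closedin (top_of_set (carrier G_A)) H"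
    and I_def: "I = closed_ideal hull {x. emb x \<in> lie_bracket H (range emb)}"
  shows "closed_comm_subgroup I \<subseteq> H" "H \<subseteq> G_rel I"
proof -
  interpret H: normal H "G_A :: ('a \<times> complex) monoid" by fact
  interpret U: vector_space "uscale :: complex \<Rightarrow> 'a \<times> complex \<Rightarrow> 'a \<times> complex"
    by (rule vector_space_uscale)
  have I: "closed_ideal I"
    unfolding I_def by (rule closed_ideal_hull)
  define H' where "H' = {u \<in> G\<^sub>U. to_pair u \<in> H}"
  have H': "closed_normal_subgroup (range embed) G\<^sub>U H'"
    unfolding H'_def
    using H.one_closed H.m_closed H.inv_op_closed2 by (intro pull_back_closed_normal closed)
  have bracket_I: "alg h * a - a * alg h \<in> I" if "to_pair h \<in> H" for h a
  proof -
    have "emb (alg h * a - a * alg h) \<in> lie_bracket H (range emb)"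
      unfolding lie_bracket_def bracket_to_pair[symmetric] using that by (intro U.span_base) blast
    then have "alg h * a - a * alg h \<in> {x. emb x \<in> lie_bracket H (range emb)}"
      by simp
    then show ?thesis
      unfolding I_def by (rule subsetD[OF hull_subset])
  qed
  have least: "I \<subseteq> K" if K: "closed_ideal K" and brackets: "\<And>h a. h \<in> H' \<Longrightarrow> alg h * a - a * alg h \<in> K" for K
    unfolding I_def
  proof (rule hull_minimal[where S = closed_ideal, OF _ K])
    have "U.subspace (emb ` K)"
      unfolding U.subspace_def
    proof (intro conjI ballI allI)
      show "0 \<in> emb ` K"
        using closed_idealD(1)[OF K] by (intro image_eqI[of _ _ 0]) (simp_all add: emb_def zero_prod_def)
      show "x + y \<in> emb ` K" if "x \<in> emb ` K" "y \<in> emb ` K" for x y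
        using that closed_idealD(2)[OF K] by (auto simp flip: emb_add)
      show "uscale c x \<in> emb ` K" if "x \<in> emb ` K" for c x
      proof -
        from that obtain y where "y \<in> K" "x = emb y" by auto
        then show ?thesis
          using closed_idealD(5)[OF K] by (intro image_eqI[of _ _ "c *\<^sub>C y"]) (simp_all add: uscale_def emb_def)
      qed
    qed
    moreover have "{umult x y - umult y x | x y. x \<in> H \<and> y \<in> range emb} \<subseteq> emb ` K"
    proof
      fix q assume "q \<in> {umult x y - umult y x | x y. x \<in> H \<and> y \<in> range emb}"
      then obtain p and a :: 'a where q: "q = umult p (emb a) - umult (emb a) p" and p: "p \<in> H"
        by blast
      from p obtain h where h: "h \<in> G\<^sub>U" "p = to_pair h"
        using H.subset unfolding carrier_G_A by blast
      then have "h \<in> H'"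
        using p by (simp add: H'_def)
      then show "q \<in> emb ` K"
        unfolding q h(2) bracket_to_pair by (intro imageI brackets)
    qed
    ultimately have "lie_bracket H (range emb) \<subseteq> emb ` K"
      unfolding lie_bracket_def by (rule U.span_minimal[rotated])
    then show "{x. emb x \<in> lie_bracket H (range emb)} \<subseteq> K"
      by (auto simp: emb_def)
  qed
  have comm_H: "commutator p q \<in> H" if p: "p \<in> G_ideal I" and q: "q \<in> carrier G_A" for p q
  proof -
    from p obtain k where k: "k \<in> id_component I" "p = to_pair k"
      unfolding G_ideal_eq[OF I] by blast
    then have kG: "k \<in> G\<^sub>U"
      using id_component_mono[of I UNIV] by auto
    obtain k' where k': "k * k' = 1" "k' * k = 1"
      using inverse_id_component[OF closed_ideal_UNIV kG] by blast
    from q obtain g g' where g: "q = to_pair g" "g \<in> G\<^sub>U" "g * g' = 1" "g' * g = 1"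
      by (rule carrier_G_AE)
    have "k * g * k' * g' \<in> H'"
    proof (rule commutators_with_ideal_in_normal_subgroup[OF H' _ _ I least k(1) k' g(2-4)])
      show "k \<in> H'" if "h \<in> H'" "h * k = 1" "k * h = 1" for h k
        using that to_pair_G_inv[of h k] inverse_G_unique[of h k] H.m_inv_closed[of "to_pair h"]
        by (simp add: H'_def)
    qed (auto simp: H'_def)
    then show ?thesis
      by (simp add: H'_def to_pair_commutator[OF kG k' g(2-4)] k(2) g(1))
  qed
  have "comm_subgroup (G_ideal I) (carrier G_A) \<subseteq> H"
    unfolding comm_subgroup_def
    by (rule G_A.generate_subgroup_incl[OF _ H.subgroup_axioms]) (use comm_H in blast)
  then show "closed_comm_subgroup I \<subseteq> H"
    unfolding closed_comm_subgroup_def using closed by (rule closure_of_minimal)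
  let ?N = "{u \<in> G\<^sub>U. to_pair u \<in> closed_comm_subgroup I}"
  have N: "closed_normal_subgroup (range embed) G\<^sub>U ?N"
  proof (rule pull_back_closed_normal)
    show "closedin (top_of_set (carrier G_A)) (closed_comm_subgroup I)"
      unfolding closed_comm_subgroup_def by (rule closedin_closure_of)
  qed (fact closed_comm_subgroup_normal[OF I])+
  have comm_N: "k * g * k' * g' \<in> ?N"
    if k: "k \<in> id_component I" "k * k' = 1" "k' * k = 1" and g: "g \<in> G\<^sub>U" "g * g' = 1" "g' * g = 1" for k k' g g'
  proof -
    have kG: "k \<in> G\<^sub>U"
      using k(1) id_component_mono[of I UNIV] by auto
    have "commutator (to_pair k) (to_pair g) \<in> comm_subgroup (G_ideal I) (carrier G_A)"
      unfolding comm_subgroup_def G_ideal_eq[OF I] using k(1) to_pair_G[OF g(1)]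
      by (intro generate.incl) blast
    then have "to_pair (k * g * k' * g') \<in> closed_comm_subgroup I"
      unfolding to_pair_commutator[OF kG k(2,3) g] using comm_subset_closed_comm[OF I] by blast
    then show ?thesis
      by (simp add: mult_id_component[OF closed_ideal_UNIV] kG g(1) inverse_G_unique[OF kG k(2,3)]
          inverse_G_unique[OF g])
  qed
  show "H \<subseteq> G_rel I"
  proof
    fix p assume p: "p \<in> H"
    then have pG: "p \<in> carrier G_A"
      using H.subset by blast
    then obtain h h' where h: "p = to_pair h" "h \<in> G\<^sub>U" "h * h' = 1" "h' * h = 1"
      by (rule carrier_G_AE)
    have central: "alg h * a - a * alg h \<in> I" for a
      using p unfolding h(1) by (rule bracket_I)
    have "commutator p q \<in> closed_comm_subgroup I" if "q \<in> carrier G_A" for q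
    proof -
      from that obtain g g' where g: "q = to_pair g" "g \<in> G\<^sub>U" "g * g' = 1" "g' * g = 1"
        by (rule carrier_G_AE)
      have "h * g * h' * g' \<in> ?N"
        by (rule commutators_of_elements_central_mod_ideal[OF N I comm_N h(2-4) central g(2-4)])
      then show ?thesis
        by (simp add: to_pair_commutator[OF h(2-4) g(2-4)] h(1) g(1))
    qed
    then show "p \<in> G_rel I"
      unfolding G_rel_def using comm_subgroup_singleton_subset[OF I pG] pG by blast
  qed
qed

text \<open>One has \<open>g h g\<^sup>-\<^sup>1 = (h, g)\<^sup>-\<^sup>1 h\<close>, and \<open>h \<in> G_rel I\<close> puts \<open>(h, g)\<close> into \<open>closed_comm_subgroup I \<subseteq> H\<close>.\<close>

lemma sandwiched_subgroup_normal:
  fixes H :: "('a::cstar_algebra \<times> complex) set"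
  assumes H: "subgroup H G_A" and sandwich: "closed_comm_subgroup I \<subseteq> H" "H \<subseteq> G_rel I"
  shows "H \<lhd> G_A"
proof (rule G_A.normal_invI[OF H])
  interpret H: subgroup H "G_A :: ('a \<times> complex) monoid" by fact
  fix g h :: "'a \<times> complex" assume g: "g \<in> carrier G_A" and h: "h \<in> H"
  have hG: "h \<in> carrier G_A"
    using h H.subset by blast
  have "commutator h g \<in> comm_subgroup {h} (carrier G_A)"
    unfolding comm_subgroup_def using g by (intro generate.incl) blast
  then have "commutator h g \<in> H"
    using h sandwich unfolding G_rel_def by blast
  then have "inv\<^bsub>G_A\<^esub> (commutator h g) \<otimes>\<^bsub>G_A\<^esub> h \<in> H"
    using h by simp
  also have "inv\<^bsub>G_A\<^esub> (commutator h g) \<otimes>\<^bsub>G_A\<^esub> h = g \<otimes>\<^bsub>G_A\<^esub> h \<otimes>\<^bsub>G_A\<^esub> inv\<^bsub>G_A\<^esub> g"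
    using g hG by (simp add: G_A.m_assoc G_A.inv_mult_group)
  finally show "g \<otimes>\<^bsub>G_A\<^esub> h \<otimes>\<^bsub>G_A\<^esub> inv\<^bsub>G_A\<^esub> g \<in> H" .
qed

theorem mainTheorem2:
  shows "(\<forall>H :: ('a::cstar_algebra \<times> complex) set.
            H \<lhd> G_A \<and> closedin (top_of_set (carrier G_A)) H \<longrightarrow>
            (\<exists>I. closed_ideal I \<and>
                 I = closed_ideal hull {x. emb x \<in> lie_bracket H (range emb)} \<and>
                 closed_comm_subgroup I \<subseteq> H \<and> H \<subseteq> G_rel I)) \<and>
         (\<forall>(I :: 'a set) H.
            closed_ideal I \<and> subgroup H G_A \<and> closed_comm_subgroup I \<subseteq> H \<and> H \<subseteq> G_rel I \<longrightarrow>
            H \<lhd> G_A)"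
proof (intro conjI allI impI)
  fix H :: "('a \<times> complex) set"
  assume "H \<lhd> G_A \<and> closedin (top_of_set (carrier G_A)) H"
  then show "\<exists>I. closed_ideal I \<and>
      I = closed_ideal hull {x. emb x \<in> lie_bracket H (range emb)} \<and>
      closed_comm_subgroup I \<subseteq> H \<and> H \<subseteq> G_rel I"
    by (intro exI[of _ "closed_ideal hull {x. emb x \<in> lie_bracket H (range emb)}"])
      (simp add: closed_ideal_hull closed_normal_subgroup_sandwich)
next
  fix I :: "'a set" and H
  assume "closed_ideal I \<and> subgroup H G_A \<and> closed_comm_subgroup I \<subseteq> H \<and> H \<subseteq> G_rel I"
  then show "H \<lhd> G_A"
    by (elim conjE) (rule sandwiched_subgroup_normal)
qed

end
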